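(* Let $G = G_1 * \cdots * G_n$ be the free product of torsion-free groups $G_1, \dots, G_n$. Suppose that $g \in G$ is a generalized torsion element of $G$. Then, for some $i \in \{1, \dots, n\}$, there is a generalized torsion element $g_i$ of the group $G_i$ which is conjugate to $g$ in $G$. Hence, $G$ has a generalized torsion element if and only if $G_i$ has a generalized torsion element for some $i$.
   Context: A nontrivial element $g$ of a group $H$ is a generalized torsion element of $H$ if some nonempty finite product of its conjugates is the identity, i.e. there are $k \ge 1$ and $x_1, \dots, x_k \in H$ with $(x_1 g x_1^{-1})(x_2 g x_2^{-1}) \cdots (x_k g x_k^{-1}) = 1$. Each factor $G_i$ is regarded as a subgroup of the free product $G$ via the canonical inclusion; for a generalized torsion element of $G_i$ the conjugating elements are taken in $G_i$. *)

theory Defs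
  imports "HOL-Algebra.Group"
begin

section \<open>Free products of groups\<close>

text \<open>
  The free product of a family of groups \<open>G i\<close>, \<open>i \<in> I\<close>, is realised as the group of reduced
  words: lists of syllables \<open>(i, x)\<close> with \<open>x\<close> a nontrivial element of \<open>G i\<close>, in which adjacent
  syllables come from different factors. All factors share the carrier type \<open>'a\<close>.
\<close>

definition reduced_words :: "'i set \<Rightarrow> ('i \<Rightarrow> ('a, 'b) monoid_scheme) \<Rightarrow> ('i \<times> 'a) list set" where
  "reduced_words I G =
     {w. (\<forall>(i, x) \<in> set w. i \<in> I \<and> x \<in> carrier (G i) \<and> x \<noteq> \<one>\<^bsub>G i\<^esub>) \<and> distinct_adj (map fst w)}"

text \<open>
  Left multiplication of a reduced word by one (possibly trivial) syllable, followed by reduction.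
  One step suffices: when a syllable cancels, what remains is the tail of a reduced word.
\<close>

fun syllable_mult ::
  "('i \<Rightarrow> ('a, 'b) monoid_scheme) \<Rightarrow> 'i \<times> 'a \<Rightarrow> ('i \<times> 'a) list \<Rightarrow> ('i \<times> 'a) list" where
  "syllable_mult G (i, x) [] = (if x = \<one>\<^bsub>G i\<^esub> then [] else [(i, x)])"
| "syllable_mult G (i, x) ((j, y) # w) =
     (if x = \<one>\<^bsub>G i\<^esub> then (j, y) # w
      else if i \<noteq> j then (i, x) # (j, y) # w
      else if x \<otimes>\<^bsub>G i\<^esub> y = \<one>\<^bsub>G i\<^esub> then w
      else (i, x \<otimes>\<^bsub>G i\<^esub> y) # w)"

definition free_product ::
  "'i set \<Rightarrow> ('i \<Rightarrow> ('a, 'b) monoid_scheme) \<Rightarrow> ('i \<times> 'a) list monoid" where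
  "free_product I G =
     \<lparr>carrier = reduced_words I G,
      mult = (\<lambda>u v. foldr (syllable_mult G) u v),
      one = []\<rparr>"

definition free_product_incl :: "('i \<Rightarrow> ('a, 'b) monoid_scheme) \<Rightarrow> 'i \<Rightarrow> 'a \<Rightarrow> ('i \<times> 'a) list" where
  "free_product_incl G i x = (if x = \<one>\<^bsub>G i\<^esub> then [] else [(i, x)])"


section \<open>Torsion, conjugacy and generalized torsion\<close>

definition torsion_free :: "('a, 'b) monoid_scheme \<Rightarrow> bool" where
  "torsion_free H \<longleftrightarrow>
     (\<forall>x \<in> carrier H. \<forall>n::nat. 0 < n \<and> x [^]\<^bsub>H\<^esub> n = \<one>\<^bsub>H\<^esub> \<longrightarrow> x = \<one>\<^bsub>H\<^esub>)"

definition conjugate_in :: "('a, 'b) monoid_scheme \<Rightarrow> 'a \<Rightarrow> 'a \<Rightarrow> bool" where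
  "conjugate_in H a b \<longleftrightarrow> (\<exists>h \<in> carrier H. b = h \<otimes>\<^bsub>H\<^esub> a \<otimes>\<^bsub>H\<^esub> inv\<^bsub>H\<^esub> h)"

definition generalized_torsion :: "('a, 'b) monoid_scheme \<Rightarrow> 'a \<Rightarrow> bool" where
  "generalized_torsion H g \<longleftrightarrow>
     g \<in> carrier H \<and> g \<noteq> \<one>\<^bsub>H\<^esub> \<and>
     (\<exists>xs. xs \<noteq> [] \<and> set xs \<subseteq> carrier H \<and>
        foldr (\<otimes>\<^bsub>H\<^esub>) (map (\<lambda>x. x \<otimes>\<^bsub>H\<^esub> g \<otimes>\<^bsub>H\<^esub> inv\<^bsub>H\<^esub> x) xs) \<one>\<^bsub>H\<^esub> = \<one>\<^bsub>H\<^esub>)"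


section \<open>The free product is a group with the expected universal property\<close>

lemma free_product_simps [simp]:
  "carrier (free_product I G) = reduced_words I G"
  "mult (free_product I G) u v = foldr (syllable_mult G) u v"
  "one (free_product I G) = []"
  by (simp_all add: free_product_def)

lemma reduced_words_Nil [simp]: "[] \<in> reduced_words I G"
  by (simp add: reduced_words_def)

lemma reduced_words_Cons:
  "(i, x) # w \<in> reduced_words I G \<longleftrightarrow>
     i \<in> I \<and> x \<in> carrier (G i) \<and> x \<noteq> \<one>\<^bsub>G i\<^esub> \<and> w \<in> reduced_words I G \<and> (w = [] \<or> i \<noteq> fst (hd w))"
  by (auto simp: reduced_words_def distinct_adj_Cons hd_map)

lemma syllable_mult_one [simp]: "syllable_mult G (i, \<one>\<^bsub>G i\<^esub>) w = w"
  by (cases w) auto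

lemma syllable_mult_Cons:
  assumes "(i, x) # w \<in> reduced_words I G"
  shows "syllable_mult G (i, x) w = (i, x) # w"
  using assms by (cases w) (auto simp: reduced_words_Cons)

lemma syllable_mult_closed:
  assumes "\<And>i. i \<in> I \<Longrightarrow> group (G i)" "i \<in> I" "x \<in> carrier (G i)" "w \<in> reduced_words I G"
  shows "syllable_mult G (i, x) w \<in> reduced_words I G"
proof -
  interpret group "G i" using assms by auto
  show ?thesis
  proof (cases w)
    case Nil
    then show ?thesis using assms by (auto simp: reduced_words_Cons)
  next
    case (Cons a v)
    then show ?thesis using assms by (cases a) (auto simp: reduced_words_Cons)
  qed
qed

lemma syllable_mult_mult:
  assumes "\<And>i. i \<in> I \<Longrightarrow> group (G i)" "i \<in> I" "x \<in> carrier (G i)" "y \<in> carrier (G i)"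
    and "w \<in> reduced_words I G"
  shows "syllable_mult G (i, x) (syllable_mult G (i, y) w) = syllable_mult G (i, x \<otimes>\<^bsub>G i\<^esub> y) w"
proof -
  interpret group "G i" using assms by auto
  have main: ?thesis if "x \<noteq> \<one>\<^bsub>G i\<^esub>" "y \<noteq> \<one>\<^bsub>G i\<^esub>"
  proof (cases "w = [] \<or> fst (hd w) \<noteq> i")
    case True
    then show ?thesis using assms that by (cases w) (auto simp: reduced_words_Cons)
  next
    case False
    then obtain z v where w: "w = (i, z) # v" by (cases w) auto
    with assms have z: "z \<in> carrier (G i)" "z \<noteq> \<one>\<^bsub>G i\<^esub>" and v: "v = [] \<or> i \<noteq> fst (hd v)"
      by (auto simp: reduced_words_Cons)
    have assoc: "x \<otimes>\<^bsub>G i\<^esub> (y \<otimes>\<^bsub>G i\<^esub> z) = x \<otimes>\<^bsub>G i\<^esub> y \<otimes>\<^bsub>G i\<^esub> z"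
      using assms z by (simp add: m_assoc)
    have fresh: "syllable_mult G (i, x) v = (i, x) # v"
      using v that by (cases v) auto
    show ?thesis
    proof (cases "y \<otimes>\<^bsub>G i\<^esub> z = \<one>\<^bsub>G i\<^esub>")
      case True
      then have "x \<otimes>\<^bsub>G i\<^esub> y \<otimes>\<^bsub>G i\<^esub> z = x" using assoc assms by simp
      then show ?thesis using w that fresh True z by (auto simp: assms)
    next
      case False
      moreover have "y \<otimes>\<^bsub>G i\<^esub> z = z" if "x \<otimes>\<^bsub>G i\<^esub> y = \<one>\<^bsub>G i\<^esub>" "x \<otimes>\<^bsub>G i\<^esub> (y \<otimes>\<^bsub>G i\<^esub> z) = \<one>\<^bsub>G i\<^esub>"
        using that assoc assms z by auto
      ultimately show ?thesis using w that assoc z by (auto simp: assms)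
    qed
  qed
  show ?thesis
    using main assms by (cases "x = \<one>\<^bsub>G i\<^esub>"; cases "y = \<one>\<^bsub>G i\<^esub>") auto
qed

lemma foldr_syllable_mult_closed:
  assumes "\<And>i. i \<in> I \<Longrightarrow> group (G i)" "u \<in> reduced_words I G" "v \<in> reduced_words I G"
  shows "foldr (syllable_mult G) u v \<in> reduced_words I G"
  using assms(2)
proof (induction u)
  case (Cons a u)
  then show ?case using assms
    by (cases a) (auto simp: reduced_words_Cons intro!: syllable_mult_closed)
qed (use assms in auto)

lemma foldr_syllable_mult_syllable:
  assumes "\<And>i. i \<in> I \<Longrightarrow> group (G i)" "i \<in> I" "x \<in> carrier (G i)"
    and "u \<in> reduced_words I G" "v \<in> reduced_words I G"
  shows "foldr (syllable_mult G) (syllable_mult G (i, x) u) v =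
         syllable_mult G (i, x) (foldr (syllable_mult G) u v)"
proof (cases u)
  case Nil
  then show ?thesis by auto
next
  case (Cons a w)
  obtain j y where a: "a = (j, y)" by (cases a)
  interpret group "G i" using assms by auto
  have w: "w \<in> reduced_words I G" and y: "y \<in> carrier (G j)"
    using assms Cons a by (auto simp: reduced_words_Cons)
  have c: "foldr (syllable_mult G) w v \<in> reduced_words I G"
    using assms w by (intro foldr_syllable_mult_closed)
  show ?thesis
  proof (cases "i = j")
    case True
    then have "syllable_mult G (i, x) (syllable_mult G (i, y) (foldr (syllable_mult G) w v)) =
      syllable_mult G (i, x \<otimes>\<^bsub>G i\<^esub> y) (foldr (syllable_mult G) w v)"
      using syllable_mult_mult[of I G i x y] assms c y by auto
    then show ?thesis using True Cons a y by auto
  qed (use Cons a in auto)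
qed

lemma foldr_syllable_mult_assoc:
  assumes "\<And>i. i \<in> I \<Longrightarrow> group (G i)"
    and "u \<in> reduced_words I G" "v \<in> reduced_words I G" "w \<in> reduced_words I G"
  shows "foldr (syllable_mult G) (foldr (syllable_mult G) u v) w =
         foldr (syllable_mult G) u (foldr (syllable_mult G) v w)"
  using assms(2)
proof (induction u)
  case (Cons a u)
  obtain i x where a: "a = (i, x)" by (cases a)
  with Cons have *: "i \<in> I" "x \<in> carrier (G i)" "u \<in> reduced_words I G"
    by (auto simp: reduced_words_Cons)
  have "foldr (syllable_mult G) u v \<in> reduced_words I G"
    using assms * by (intro foldr_syllable_mult_closed)
  then show ?case
    using foldr_syllable_mult_syllable[of I G i x _ w] assms * Cons.IH a by simp
qed auto

lemma foldr_syllable_mult_Nil: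
  assumes "u \<in> reduced_words I G"
  shows "foldr (syllable_mult G) u [] = u"
  using assms
proof (induction u)
  case (Cons a u)
  then show ?case using syllable_mult_Cons[of "fst a" "snd a" u I G]
    by (cases a) (auto simp: reduced_words_Cons)
qed auto

lemma free_product_left_inverse:
  assumes "\<And>i. i \<in> I \<Longrightarrow> group (G i)" "u \<in> reduced_words I G"
  shows "\<exists>v \<in> reduced_words I G. foldr (syllable_mult G) v u = []"
  using assms(2)
proof (induction u)
  case (Cons a u)
  obtain i x where a: "a = (i, x)" by (cases a)
  with Cons have *: "i \<in> I" "x \<in> carrier (G i)" "x \<noteq> \<one>\<^bsub>G i\<^esub>" "u \<in> reduced_words I G"
    by (auto simp: reduced_words_Cons)
  interpret group "G i" using assms * by auto
  obtain v where v: "v \<in> reduced_words I G" "foldr (syllable_mult G) v u = []"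
    using Cons.IH * by blast
  have "inv\<^bsub>G i\<^esub> x \<noteq> \<one>\<^bsub>G i\<^esub>" using * by (metis inv_inv inv_one)
  then have s: "[(i, inv\<^bsub>G i\<^esub> x)] \<in> reduced_words I G"
    using * by (auto simp: reduced_words_Cons)
  have "foldr (syllable_mult G) (foldr (syllable_mult G) v [(i, inv\<^bsub>G i\<^esub> x)]) (a # u) =
        foldr (syllable_mult G) v (foldr (syllable_mult G) [(i, inv\<^bsub>G i\<^esub> x)] (a # u))"
    using foldr_syllable_mult_assoc[of I G] assms(1) v s Cons.prems by blast
  also have "foldr (syllable_mult G) [(i, inv\<^bsub>G i\<^esub> x)] (a # u) = u"
    using a * \<open>inv\<^bsub>G i\<^esub> x \<noteq> \<one>\<^bsub>G i\<^esub>\<close> by simp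
  finally show ?case
    using foldr_syllable_mult_closed[of I G, OF assms(1) v(1) s] v by metis
qed (auto intro: bexI[of _ "[]"])

lemma group_free_product:
  assumes "\<And>i. i \<in> I \<Longrightarrow> group (G i)"
  shows "group (free_product I G)"
proof (rule groupI)
  fix x assume "x \<in> carrier (free_product I G)"
  then show "\<exists>y\<in>carrier (free_product I G). y \<otimes>\<^bsub>free_product I G\<^esub> x = \<one>\<^bsub>free_product I G\<^esub>"
    using free_product_left_inverse[of I G x] assms by auto
qed (use assms in \<open>auto intro: foldr_syllable_mult_closed foldr_syllable_mult_assoc\<close>)

lemma free_product_incl_hom:
  assumes "\<And>i. i \<in> I \<Longrightarrow> group (G i)" "i \<in> I"
  shows "free_product_incl G i \<in> hom (G i) (free_product I G)"
  by (rule homI) (auto simp: free_product_incl_def reduced_words_Cons assms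
      group.is_monoid monoid.l_one monoid.r_one)

lemma inj_free_product_incl: "inj (free_product_incl G i)"
  by (auto simp: inj_def free_product_incl_def split: if_splits)

theorem free_product_universal:
  assumes G: "\<And>i. i \<in> I \<Longrightarrow> group (G i)" and H: "group H"
    and f: "\<And>i. i \<in> I \<Longrightarrow> f i \<in> hom (G i) H"
  shows "\<exists>F \<in> hom (free_product I G) H.
           (\<forall>i \<in> I. \<forall>x \<in> carrier (G i). F (free_product_incl G i x) = f i x) \<and>
           (\<forall>F' \<in> hom (free_product I G) H.
             (\<forall>i \<in> I. \<forall>x \<in> carrier (G i). F' (free_product_incl G i x) = f i x) \<longrightarrow>
             (\<forall>w \<in> carrier (free_product I G). F' w = F w))"
proof -
  interpret H: group H by fact
  interpret P: group "free_product I G" using G by (rule group_free_product)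
  define F where "F = (\<lambda>w. foldr (\<lambda>(i, x) h. f i x \<otimes>\<^bsub>H\<^esub> h) w \<one>\<^bsub>H\<^esub>)"
  have F_simps [simp]: "F [] = \<one>\<^bsub>H\<^esub>" "F ((i, x) # w) = f i x \<otimes>\<^bsub>H\<^esub> F w" for i x w
    by (auto simp: F_def)
  have fc [simp]: "f i x \<in> carrier H" if "i \<in> I" "x \<in> carrier (G i)" for i x
    using f that by (auto simp: hom_def)
  have fm: "f i (x \<otimes>\<^bsub>G i\<^esub> y) = f i x \<otimes>\<^bsub>H\<^esub> f i y"
    if "i \<in> I" "x \<in> carrier (G i)" "y \<in> carrier (G i)" for i x y
    using f that by (auto simp: hom_def)
  have f1 [simp]: "f i \<one>\<^bsub>G i\<^esub> = \<one>\<^bsub>H\<^esub>" if "i \<in> I" for i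
    using hom_one[OF f[OF that] G[OF that] H] .
  have Fc [simp]: "F w \<in> carrier H" if "w \<in> reduced_words I G" for w
    using that by (induction w) (auto simp: reduced_words_Cons)
  have Fs: "F (syllable_mult G (i, x) w) = f i x \<otimes>\<^bsub>H\<^esub> F w"
    if "i \<in> I" "x \<in> carrier (G i)" "w \<in> reduced_words I G" for i x w
  proof (cases w)
    case Nil
    then show ?thesis using that by auto
  next
    case (Cons a v)
    obtain j y where a: "a = (j, y)" by (cases a)
    have v: "v \<in> reduced_words I G" and y: "j \<in> I" "y \<in> carrier (G j)"
      using that Cons a by (auto simp: reduced_words_Cons)
    have *: "f i x \<otimes>\<^bsub>H\<^esub> (f i y \<otimes>\<^bsub>H\<^esub> F v) = f i (x \<otimes>\<^bsub>G i\<^esub> y) \<otimes>\<^bsub>H\<^esub> F v" if "i = j"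
      using that y v \<open>i \<in> I\<close> \<open>x \<in> carrier (G i)\<close> by (simp add: fm H.m_assoc)
    show ?thesis using Cons a v y that * by auto
  qed
  have Fm: "F (foldr (syllable_mult G) u v) = F u \<otimes>\<^bsub>H\<^esub> F v"
    if "u \<in> reduced_words I G" "v \<in> reduced_words I G" for u v
    using that(1)
  proof (induction u)
    case (Cons a u)
    then show ?case
      using that(2) foldr_syllable_mult_closed[of I G u v] G
      by (cases a) (auto simp: reduced_words_Cons Fs H.m_assoc)
  qed (use that in auto)
  have hom: "F \<in> hom (free_product I G) H"
    by (rule homI) (auto simp: Fm)
  have unique: "F' w = F w"
    if F': "F' \<in> hom (free_product I G) H"
      and ext: "\<forall>i \<in> I. \<forall>x \<in> carrier (G i). F' (free_product_incl G i x) = f i x"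
      and "w \<in> reduced_words I G" for F' w
    using that(3)
  proof (induction w)
    case Nil
    then show ?case using hom_one[OF F' P.is_group H] by simp
  next
    case (Cons a w)
    obtain i x where a: "a = (i, x)" by (cases a)
    with Cons.prems have *: "i \<in> I" "x \<in> carrier (G i)" "x \<noteq> \<one>\<^bsub>G i\<^esub>" "w \<in> reduced_words I G"
      "[(i, x)] \<in> reduced_words I G" by (auto simp: reduced_words_Cons)
    have "a # w = [(i, x)] \<otimes>\<^bsub>free_product I G\<^esub> w"
      using Cons.prems a by (simp add: syllable_mult_Cons)
    then have "F' (a # w) = F' [(i, x)] \<otimes>\<^bsub>H\<^esub> F' w"
      using hom_mult[OF F', of "[(i, x)]" w] * by simp
    moreover have "F' [(i, x)] = f i x"
      using ext * by (auto simp: free_product_incl_def split: if_splits)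
    ultimately show ?case using Cons.IH * a by simp
  qed
  show ?thesis
    using hom unique by (intro bexI[of _ F]) (auto simp: free_product_incl_def)
qed

end

theory Submission
  imports Defs "HOL-Combinatorics.Cycles"
begin

text \<open>
  Conjugate \<open>g\<close> to a cyclically reduced word. If a single syllable \<open>(i, x)\<close> is left, the retraction of
  the free product onto the factor \<open>G i\<close> turns the relation for \<open>g\<close> into one for \<open>x\<close>, so \<open>x\<close> is a
  generalized torsion element of \<open>G i\<close>. The point of the theorem is that nothing else can
  happen: if \<open>g\<close> is cyclically reduced with \<open>m \<ge> 2\<close> syllables, no product of \<open>k \<ge> 1\<close> of its conjugates
  is trivial (\<open>not_generalized_torsion_cyclically_reduced\<close>).

  The reason is topological. A trivial product of \<open>k\<close> conjugates of \<open>g\<close> is a map from a sphere with \<open>k\<close>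
  holes to a wedge of spaces with fundamental groups \<open>G i\<close>, each boundary circle running along \<open>g\<close>. The
  surface falls into pieces that lie over the factors and junctions that lie over the wedge point. The
  \<open>k m\<close> letters on the boundary circles are permuted in two ways: \<open>\<tau>\<close> moves to the next letter of the
  circle, \<open>\<sigma>\<close> moves to the next letter around a piece, and the junctions are traversed by \<open>\<tau> \<sigma>\<^sup>-\<^sup>1\<close>. As the
  Euler characteristic of the surface is \<open>2 - k\<close> and only discs contribute positively to it, there are
  at least \<open>k m + 2 - k\<close> discs among the pieces and junctions.

  On the other hand let \<open>p z\<close>, an integer modulo \<open>m\<close>, be the position in \<open>g\<close> of the letter \<open>z\<close>. Charge
  \<open>(p z - p (\<sigma> z)) mod m\<close> to the step from \<open>z\<close> to \<open>\<sigma> z\<close> around a piece, and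
  \<open>(p (\<sigma> z) - p (\<tau> z)) mod m\<close> to the step from \<open>\<sigma> z\<close> to \<open>\<tau> z\<close> around a junction. Since
  \<open>p (\<tau> z) = p z + 1\<close>, the two charges add up to \<open>m - 1\<close>, which makes \<open>k m (m - 1)\<close> in total. The charge
  around any piece or junction is a multiple of \<open>m\<close>. It is not \<open>0\<close> on a disc over a factor, where all
  letters would be equal to some \<open>x\<close> and give \<open>x\<^sup>r = 1\<close>, against torsion-freeness. It is not \<open>0\<close> on a
  junction, where two cyclically adjacent syllables of \<open>g\<close> would lie in the same factor. Hence there are
  at most \<open>k (m - 1) = k m - k\<close> discs (\<open>diagram_bound\<close>), a contradiction.

  No surface appears below. A \<open>diagram\<close> records the permutations \<open>\<sigma>\<close>, \<open>\<tau>\<close> and enough discs. One exists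
  for every nonempty word that represents the identity (\<open>diagram_of_trivial_word\<close>), where the surface is
  a disc. For the word \<open>g (u\<^sub>1 g u\<^sub>1\<^sup>-\<^sup>1) (u\<^sub>2 g u\<^sub>2\<^sup>-\<^sup>1) \<dots>\<close> the letters of \<open>u\<^sub>j\<close> are then glued to those of \<open>u\<^sub>j\<^sup>-\<^sup>1\<close>,
  one pair at a time. Each \<open>j\<close> opens one new hole, and the number of discs minus the number of letters
  drops by at most one for each of them (\<open>diagram_split_conjugates\<close>).
\<close>

section \<open>Products of conjugates in groups\<close>

lemma (in group) inv_mult_cancel:
  assumes "a \<in> carrier G" "b \<in> carrier G"
  shows "inv a \<otimes> (a \<otimes> b) = b" "a \<otimes> (inv a \<otimes> b) = b"
  using assms by (simp_all add: m_assoc[symmetric])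

lemma (in group) conjugate_conjugate:
  assumes "a \<in> carrier G" "b \<in> carrier G" "g \<in> carrier G"
  shows "a \<otimes> (b \<otimes> g \<otimes> inv b) \<otimes> inv a = (a \<otimes> b) \<otimes> g \<otimes> inv (a \<otimes> b)"
  using assms by (simp add: m_assoc inv_mult_group)

lemma (in group) conjugate_inv_conjugate:
  assumes "a \<in> carrier G" "g \<in> carrier G"
  shows "inv a \<otimes> (a \<otimes> g \<otimes> inv a) \<otimes> inv (inv a) = g"
  using assms by (simp add: m_assoc inv_mult_cancel)

text \<open>
  With \<open>v\<close> the inverse of the first conjugator, this makes the first conjugator of a product trivial.
\<close>
lemma (in group) foldr_conjugates_shift:
  assumes "g \<in> carrier G" "v \<in> carrier G" "set xs \<subseteq> carrier G"
  shows "foldr (\<otimes>) (map (\<lambda>x. x \<otimes> g \<otimes> inv x) xs) \<one> \<in> carrier G \<and>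
    foldr (\<otimes>) (map (\<lambda>x. x \<otimes> g \<otimes> inv x) (map ((\<otimes>) v) xs)) \<one> =
    v \<otimes> foldr (\<otimes>) (map (\<lambda>x. x \<otimes> g \<otimes> inv x) xs) \<one> \<otimes> inv v"
  using assms(3)
proof (induction xs)
  case Nil
  then show ?case using assms by simp
next
  case (Cons x xs)
  let ?p = "foldr (\<otimes>) (map (\<lambda>x. x \<otimes> g \<otimes> inv x) xs) \<one>"
  have c: "?p \<in> carrier G" "x \<in> carrier G" using Cons by auto
  have "foldr (\<otimes>) (map (\<lambda>x. x \<otimes> g \<otimes> inv x) (map ((\<otimes>) v) (x # xs))) \<one> =
    (v \<otimes> x \<otimes> g \<otimes> inv (v \<otimes> x)) \<otimes> (v \<otimes> ?p \<otimes> inv v)"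
    using Cons by simp
  also have "\<dots> = v \<otimes> (x \<otimes> g \<otimes> inv x \<otimes> ?p) \<otimes> inv v"
    using c assms by (simp add: inv_mult_group m_assoc inv_mult_cancel)
  finally show ?case using c assms by simp
qed

lemma (in group) generalized_torsion_conjugate:
  assumes g: "generalized_torsion G g" and v: "v \<in> carrier G"
  shows "generalized_torsion G (v \<otimes> g \<otimes> inv v)"
proof -
  obtain xs where gc: "g \<in> carrier G" "g \<noteq> \<one>" and xs: "xs \<noteq> []" "set xs \<subseteq> carrier G"
    "foldr (\<otimes>) (map (\<lambda>x. x \<otimes> g \<otimes> inv x) xs) \<one> = \<one>"
    using g unfolding generalized_torsion_def by blast
  have "(x \<otimes> inv v) \<otimes> (v \<otimes> g \<otimes> inv v) \<otimes> inv (x \<otimes> inv v) = x \<otimes> g \<otimes> inv x" if "x \<in> carrier G" for x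
    using that v gc by (simp add: inv_mult_group m_assoc inv_mult_cancel)
  then have "map (\<lambda>x. x \<otimes> (v \<otimes> g \<otimes> inv v) \<otimes> inv x) (map (\<lambda>x. x \<otimes> inv v) xs) =
    map (\<lambda>x. x \<otimes> g \<otimes> inv x) xs" using xs(2) by auto
  then have "foldr (\<otimes>) (map (\<lambda>x. x \<otimes> (v \<otimes> g \<otimes> inv v) \<otimes> inv x)
    (map (\<lambda>x. x \<otimes> inv v) xs)) \<one> = \<one>" using xs(3) by (rule ssubst)
  moreover have "v \<otimes> g \<otimes> inv v \<noteq> \<one>"
  proof
    assume "v \<otimes> g \<otimes> inv v = \<one>"
    then have "v \<otimes> g = v" using v gc by (metis inv_closed inv_equality inv_inv m_closed)
    then show False using v gc by simp
  qed
  ultimately show ?thesis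
    unfolding generalized_torsion_def using xs gc v
    by (intro conjI exI[of _ "map (\<lambda>x. x \<otimes> inv v) xs"]; (assumption | auto))
qed

text \<open>
  Used for both directions between a factor and the free product: along the inclusion, and along the
  retraction.
\<close>
lemma generalized_torsion_hom:
  assumes H: "group H" and K: "group K" and F: "F \<in> hom H K"
    and g: "generalized_torsion H g" and Fg: "F g \<noteq> \<one>\<^bsub>K\<^esub>"
  shows "generalized_torsion K (F g)"
proof -
  interpret group_hom H K F using H K F by (simp add: group_hom_def group_hom_axioms_def)
  obtain xs where gc: "g \<in> carrier H" and xs: "xs \<noteq> []" "set xs \<subseteq> carrier H"
    "foldr (\<otimes>\<^bsub>H\<^esub>) (map (\<lambda>x. x \<otimes>\<^bsub>H\<^esub> g \<otimes>\<^bsub>H\<^esub> inv\<^bsub>H\<^esub> x) xs) \<one>\<^bsub>H\<^esub> = \<one>\<^bsub>H\<^esub>"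
    using g unfolding generalized_torsion_def by blast
  have "foldr (\<otimes>\<^bsub>H\<^esub>) (map (\<lambda>x. x \<otimes>\<^bsub>H\<^esub> g \<otimes>\<^bsub>H\<^esub> inv\<^bsub>H\<^esub> x) ys) \<one>\<^bsub>H\<^esub> \<in> carrier H \<and>
    foldr (\<otimes>\<^bsub>K\<^esub>) (map (\<lambda>x. x \<otimes>\<^bsub>K\<^esub> F g \<otimes>\<^bsub>K\<^esub> inv\<^bsub>K\<^esub> x) (map F ys)) \<one>\<^bsub>K\<^esub> =
    F (foldr (\<otimes>\<^bsub>H\<^esub>) (map (\<lambda>x. x \<otimes>\<^bsub>H\<^esub> g \<otimes>\<^bsub>H\<^esub> inv\<^bsub>H\<^esub> x) ys) \<one>\<^bsub>H\<^esub>)"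
    if "set ys \<subseteq> carrier H" for ys
    using that gc by (induction ys) auto
  from this[OF xs(2)] show ?thesis
    unfolding generalized_torsion_def using xs gc Fg
    by (intro conjI exI[of _ "map F xs"]) auto
qed

section \<open>Words in a free product\<close>

text \<open>
  Unlike the syllables of a reduced word, letters may carry the identity.
\<close>
definition valid_letter :: "'i set \<Rightarrow> ('i \<Rightarrow> ('a, 'b) monoid_scheme) \<Rightarrow> 'i \<times> 'a \<Rightarrow> bool" where
  "valid_letter I G a \<longleftrightarrow> fst a \<in> I \<and> snd a \<in> carrier (G (fst a))"

definition inverse_letters :: "('i \<Rightarrow> ('a, 'b) monoid_scheme) \<Rightarrow> 'i \<times> 'a \<Rightarrow> 'i \<times> 'a \<Rightarrow> bool" where
  "inverse_letters G a b \<longleftrightarrow> fst a = fst b \<and> snd a \<otimes>\<^bsub>G (fst a)\<^esub> snd b = \<one>\<^bsub>G (fst a)\<^esub>"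

definition inverse_syllable :: "('i \<Rightarrow> ('a, 'b) monoid_scheme) \<Rightarrow> 'i \<times> 'a \<Rightarrow> 'i \<times> 'a" where
  "inverse_syllable G a = (fst a, inv\<^bsub>G (fst a)\<^esub> (snd a))"

lemma reduced_word_letters:
  assumes "w \<in> reduced_words I G" "a \<in> set w"
  shows "valid_letter I G a"
  using assms by (auto simp: reduced_words_def valid_letter_def)

lemma inverse_syllable_valid:
  assumes "\<And>i. i \<in> I \<Longrightarrow> group (G i)" "valid_letter I G a"
  shows "valid_letter I G (inverse_syllable G a)" "inverse_letters G a (inverse_syllable G a)"
  using assms group.inv_closed[of "G (fst a)" "snd a"] group.r_inv[of "G (fst a)" "snd a"]
  by (auto simp: valid_letter_def inverse_syllable_def inverse_letters_def)

lemma foldr_syllable_mult_valid: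
  assumes "\<And>i. i \<in> I \<Longrightarrow> group (G i)" "\<forall>a\<in>set w. valid_letter I G a" "v \<in> reduced_words I G"
  shows "foldr (syllable_mult G) w v \<in> reduced_words I G"
  using assms(2)
proof (induction w)
  case (Cons a w)
  then show ?case
    using syllable_mult_closed[of I G "fst a" "snd a"] assms(1) by (auto simp: valid_letter_def)
qed (use assms(3) in simp)

lemma foldr_syllable_mult_inverse:
  assumes G: "\<And>i. i \<in> I \<Longrightarrow> group (G i)" and u: "\<forall>a\<in>set u. valid_letter I G a"
    and v: "v \<in> reduced_words I G"
  shows "foldr (syllable_mult G) u (foldr (syllable_mult G) (rev (map (inverse_syllable G) u)) v) = v"
  using u v
proof (induction u arbitrary: v)
  case (Cons a u)
  obtain i x where a: "a = (i, x)" by (cases a)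
  have ix: "i \<in> I" "x \<in> carrier (G i)" using Cons.prems a by (auto simp: valid_letter_def)
  interpret group "G i" using G ix by auto
  let ?v = "syllable_mult G (i, inv\<^bsub>G i\<^esub> x) v"
  have "?v \<in> reduced_words I G"
    using syllable_mult_closed[OF G ix(1) _ Cons.prems(2)] ix by simp
  then have "foldr (syllable_mult G) u (foldr (syllable_mult G) (rev (map (inverse_syllable G) u)) ?v) = ?v"
    using Cons by simp
  moreover have "syllable_mult G (i, x) ?v = v"
    using syllable_mult_mult[OF G ix _ Cons.prems(2)] ix by simp
  moreover have "inverse_syllable G a = (i, inv\<^bsub>G i\<^esub> x)" by (simp add: a inverse_syllable_def)
  ultimately show ?case by (simp add: a)
qed simp

text \<open>
  The unreduced word on the left is the one whose letters serve as the letters of a diagram.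
\<close>
lemma foldr_syllable_mult_conjugate:
  assumes G: "\<And>i. i \<in> I \<Longrightarrow> group (G i)"
    and y: "y \<in> reduced_words I G" and g: "g \<in> reduced_words I G" and v: "v \<in> reduced_words I G"
  shows "foldr (syllable_mult G) (y @ g @ rev (map (inverse_syllable G) y)) v =
    (y \<otimes>\<^bsub>free_product I G\<^esub> g \<otimes>\<^bsub>free_product I G\<^esub> inv\<^bsub>free_product I G\<^esub> y) \<otimes>\<^bsub>free_product I G\<^esub> v"
proof -
  let ?P = "free_product I G"
  interpret P: group ?P using G by (rule group_free_product)
  have yv: "\<forall>a\<in>set y. valid_letter I G a"
    using y by (auto simp: reduced_words_def valid_letter_def)
  let ?t = "foldr (syllable_mult G) (rev (map (inverse_syllable G) y)) v"
  have t: "?t \<in> reduced_words I G"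
    by (rule foldr_syllable_mult_valid[OF G _ v]) (use yv inverse_syllable_valid[of I G, OF G] in auto)
  have "y \<otimes>\<^bsub>?P\<^esub> ?t = v" using foldr_syllable_mult_inverse[OF G yv v] by simp
  then have "?t = inv\<^bsub>?P\<^esub> y \<otimes>\<^bsub>?P\<^esub> v"
    using P.inv_solve_left[of ?t y v] y v t by simp
  moreover have "foldr (syllable_mult G) (y @ g @ rev (map (inverse_syllable G) y)) v = y \<otimes>\<^bsub>?P\<^esub> (g \<otimes>\<^bsub>?P\<^esub> ?t)"
    by simp
  moreover have c: "y \<in> carrier ?P" "g \<in> carrier ?P" "v \<in> carrier ?P" using y g v by simp_all
  ultimately show ?thesis using P.m_assoc P.inv_closed P.m_closed by metis
qed

lemma foldr_syllable_mult_append: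
  assumes "u @ v \<in> reduced_words I G" "v \<in> reduced_words I G"
  shows "foldr (syllable_mult G) u v = u @ v"
  using foldr_syllable_mult_Nil[OF assms(1)] foldr_syllable_mult_Nil[OF assms(2)] by simp

lemma reduced_words_appendD:
  assumes "u @ v \<in> reduced_words I G"
  shows "u \<in> reduced_words I G" "v \<in> reduced_words I G"
  using assms by (auto simp: reduced_words_def distinct_adj_append_iff)

text \<open>
  A word that begins and ends in the same factor becomes shorter when its last syllable is moved to
  the front.
\<close>
lemma conjugate_cyclically_reduced:
  assumes G: "\<And>i. i \<in> I \<Longrightarrow> group (G i)"
  shows "w \<in> reduced_words I G \<Longrightarrow> w \<noteq> [] \<Longrightarrow>
    \<exists>v h. v \<in> reduced_words I G \<and> h \<in> reduced_words I G \<and>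
      v = h \<otimes>\<^bsub>free_product I G\<^esub> w \<otimes>\<^bsub>free_product I G\<^esub> inv\<^bsub>free_product I G\<^esub> h \<and>
      v \<noteq> [] \<and> (length v = 1 \<or> fst (hd v) \<noteq> fst (last v))"
proof (induction w rule: length_induct)
  case (1 w)
  note IH = 1(1)[rule_format] and w = 1(2,3)
  let ?P = "free_product I G"
  interpret P: group ?P using G by (rule group_free_product)
  show ?case
  proof (cases "length w = 1 \<or> fst (hd w) \<noteq> fst (last w)")
    case True
    have "w = [] \<otimes>\<^bsub>?P\<^esub> w \<otimes>\<^bsub>?P\<^esub> inv\<^bsub>?P\<^esub> []"
      using P.inv_one P.r_one[of w] w by simp
    then show ?thesis using True w by (metis reduced_words_Nil)
  next
    case False
    obtain a r where ar: "w = a # r" using w by (cases w) auto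
    have "r \<noteq> []" using False ar by auto
    then obtain u b where r: "r = u @ [b]" by (metis rev_exhaust)
    obtain i x y where ab: "a = (i, x)" "b = (i, y)"
      using False ar r by (cases a; cases b) auto
    have wr: "w = ((i, x) # u) @ [(i, y)]" using ar r ab by simp
    have red: "(i, x) # u \<in> reduced_words I G" "[(i, y)] \<in> reduced_words I G"
      using w(1) reduced_words_appendD unfolding wr by blast+
    have "u \<noteq> []" using w(1) unfolding wr by (auto simp: reduced_words_Cons)
    have iy: "i \<in> I" "y \<in> carrier (G i)" "y \<noteq> \<one>\<^bsub>G i\<^esub>" using red(2) by (auto simp: reduced_words_Cons)
    define v where "v = syllable_mult G (i, y) ((i, x) # u)"
    have v: "v \<in> reduced_words I G"
      unfolding v_def by (rule syllable_mult_closed[OF G iy(1,2) red(1)])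
    have "v \<noteq> []" "length v < length w" using \<open>u \<noteq> []\<close> iy by (auto simp: v_def wr)
    have "w = ((i, x) # u) \<otimes>\<^bsub>?P\<^esub> [(i, y)]"
      using foldr_syllable_mult_append[OF w(1)[unfolded wr] red(2)] wr by simp
    moreover have "v = [(i, y)] \<otimes>\<^bsub>?P\<^esub> ((i, x) # u)" by (simp add: v_def)
    ultimately have vw: "v = [(i, y)] \<otimes>\<^bsub>?P\<^esub> w \<otimes>\<^bsub>?P\<^esub> inv\<^bsub>?P\<^esub> [(i, y)]"
      using red P.m_assoc P.r_inv P.r_one P.inv_closed P.m_closed
      unfolding free_product_simps(1)[symmetric] by metis
    obtain v' h where v': "v' \<in> reduced_words I G" "h \<in> reduced_words I G"
      "v' = h \<otimes>\<^bsub>?P\<^esub> v \<otimes>\<^bsub>?P\<^esub> inv\<^bsub>?P\<^esub> h" "v' \<noteq> []" "length v' = 1 \<or> fst (hd v') \<noteq> fst (last v')"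
      using IH[OF \<open>length v < length w\<close> v \<open>v \<noteq> []\<close>] by blast
    let ?h = "h \<otimes>\<^bsub>?P\<^esub> [(i, y)]"
    have "v' = ?h \<otimes>\<^bsub>?P\<^esub> w \<otimes>\<^bsub>?P\<^esub> inv\<^bsub>?P\<^esub> ?h"
    proof -
      have c: "h \<in> carrier ?P" "[(i, y)] \<in> carrier ?P" "w \<in> carrier ?P"
        using v' red w by simp_all
      show ?thesis unfolding v'(3) vw
        using c by (rule P.conjugate_conjugate)
    qed
    moreover have "?h \<in> reduced_words I G"
      using P.m_closed[of h "[(i, y)]"] v' red by simp
    ultimately show ?thesis using v' by blast
  qed
qed

section \<open>Diagrams of pieces and junctions\<close>

text \<open>
  The letters \<open>X\<close> on the boundary of a surface: \<open>\<tau>\<close> is the successor along the boundary, \<open>\<sigma>\<close> the successor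
  around the piece of the surface that a letter lies on, and a piece belongs to one factor. The letters
  of \<open>B\<close> lie on pieces with trivial holonomy, the discs; triviality is expressed by the potential \<open>h\<close>,
  which is easier to transport than a product around a cycle. The value of \<open>d\<close> names the disc, and
  \<open>e\<close> names the junction at which a letter starts. Junctions are the cycles of \<open>\<tau> \<sigma>\<^sup>-\<^sup>1\<close>, so invariance of
  \<open>e\<close> means that it agrees on \<open>\<sigma> z\<close> and \<open>\<tau> z\<close>. Neither \<open>d\<close> nor \<open>e\<close> has to separate cycles: counting
  unions of cycles gives a lower bound for the number of cycles, and merging two cycles is just
  identifying two names.
\<close>
locale pieces =
  fixes G :: "'i \<Rightarrow> ('a, 'b) monoid_scheme" and lab :: "'v \<Rightarrow> 'i \<times> 'a"
    and X :: "'v set" and \<sigma> \<tau> :: "'v \<Rightarrow> 'v"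
    and B :: "'v set" and h :: "'v \<Rightarrow> 'a" and d e :: "'v \<Rightarrow> nat"
  assumes fin: "finite X" and s: "\<sigma> permutes X" and t: "\<tau> permutes X"
    and lab: "z \<in> X \<Longrightarrow> group (G (fst (lab z))) \<and> snd (lab z) \<in> carrier (G (fst (lab z))) \<and>
      fst (lab (\<sigma> z)) = fst (lab z)"
    and B: "B \<subseteq> X"
    and h: "z \<in> B \<Longrightarrow> \<sigma> z \<in> B \<and> d (\<sigma> z) = d z \<and> h z \<in> carrier (G (fst (lab z))) \<and>
      h (\<sigma> z) = h z \<otimes>\<^bsub>G (fst (lab z))\<^esub> snd (lab z)"
    and e: "z \<in> X \<Longrightarrow> e (\<sigma> z) = e (\<tau> z)"

text \<open>
  The surface is glued from its pieces and junctions along \<open>card X\<close> arcs. If these are all discs, their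
  number minus \<open>card X\<close> is the Euler characteristic, and \<open>c\<close> is a lower bound for this difference.
\<close>
definition diagram ::
  "('i \<Rightarrow> ('a, 'b) monoid_scheme) \<Rightarrow> ('v \<Rightarrow> 'i \<times> 'a) \<Rightarrow> 'v set \<Rightarrow> ('v \<Rightarrow> 'v) \<Rightarrow> ('v \<Rightarrow> 'v) \<Rightarrow> int \<Rightarrow> bool" where
  "diagram G lab X \<sigma> \<tau> c \<longleftrightarrow>
     (\<exists>B h d e. pieces G lab X \<sigma> \<tau> B h d e \<and>
        c + int (card X) \<le> int (card (d ` B)) + int (card (e ` X)))"

lemma diagramI:
  assumes "pieces G lab X \<sigma> \<tau> B h d e"
    and "c + int (card X) \<le> int (card (d ` B)) + int (card (e ` X))"
  shows "diagram G lab X \<sigma> \<tau> c"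
  unfolding diagram_def using assms by blast

lemma diagramE:
  assumes "diagram G lab X \<sigma> \<tau> c"
  obtains B h d e where "pieces G lab X \<sigma> \<tau> B h d e"
    and "c + int (card X) \<le> int (card (d ` B)) + int (card (e ` X))"
  using assms unfolding diagram_def by blast

lemma diagram_D:
  assumes "diagram G lab X \<sigma> \<tau> c"
  shows "finite X" "\<sigma> permutes X" "\<tau> permutes X"
    "\<And>z. z \<in> X \<Longrightarrow> group (G (fst (lab z))) \<and> snd (lab z) \<in> carrier (G (fst (lab z))) \<and>
      fst (lab (\<sigma> z)) = fst (lab z)"
  using assms unfolding diagram_def pieces_def by blast+

lemma diagram_cong:
  assumes "diagram G lab X \<sigma> \<tau> c" "\<And>z. z \<in> X \<Longrightarrow> lab' z = lab z"
  shows "diagram G lab' X \<sigma> \<tau> c"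
proof -
  from assms(1) obtain B h d e where P: "pieces G lab X \<sigma> \<tau> B h d e"
    and c: "c + int (card X) \<le> int (card (d ` B)) + int (card (e ` X))" by (rule diagramE)
  interpret pieces G lab X \<sigma> \<tau> B h d e by (rule P)
  have "pieces G lab' X \<sigma> \<tau> B h d e"
  proof
    fix z assume z: "z \<in> X"
    then have "\<sigma> z \<in> X" using s by (simp add: permutes_in_image)
    then show "group (G (fst (lab' z))) \<and> snd (lab' z) \<in> carrier (G (fst (lab' z))) \<and>
      fst (lab' (\<sigma> z)) = fst (lab' z)"
      using lab z assms(2) by simp
  next
    fix z assume "z \<in> B"
    then show "\<sigma> z \<in> B \<and> d (\<sigma> z) = d z \<and> h z \<in> carrier (G (fst (lab' z))) \<and>
      h (\<sigma> z) = h z \<otimes>\<^bsub>G (fst (lab' z))\<^esub> snd (lab' z)"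
      using h B assms(2)[of z] by auto
  qed (use fin s t B e in auto)
  then show ?thesis using c by (rule diagramI)
qed

section \<open>Erasing, gluing and multiplying letters\<close>

text \<open>
  The map \<open>f\<close> with \<open>x\<close> skipped: the predecessor of \<open>x\<close> is sent to \<open>f x\<close>, and \<open>x\<close> becomes a fixed point.
\<close>
definition delete :: "'v \<Rightarrow> ('v \<Rightarrow> 'v) \<Rightarrow> 'v \<Rightarrow> 'v" where
  "delete x f = transpose x (f x) \<circ> f"

lemma delete_permutes:
  assumes "f permutes X" "x \<in> X"
  shows "delete x f permutes (X - {x})"
proof (rule permutes_superset)
  show "delete x f permutes X"
    unfolding delete_def using assms
    by (intro permutes_compose permutes_swap_id) (auto simp: permutes_in_image)
  show "delete x f z = z" if "z \<in> X - (X - {x})" for z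
    using that by (auto simp: delete_def)
qed

lemma delete_apply:
  assumes "f permutes X" "z \<noteq> x"
  shows "delete x f z = (if f z = x then f x else f z)"
  using assms permutes_inj[OF assms(1)]
  by (auto simp: delete_def transpose_def inj_eq)

lemma card_image_drop:
  assumes "finite S" "f ` S - {v} \<subseteq> T" "finite T"
  shows "int (card (f ` S)) - 1 \<le> int (card T)"
proof -
  have "card (f ` S) \<le> card (f ` S - {v}) + 1"
    by (metis card_Diff1_le card_Diff_singleton_if finite_imageI assms(1) le_add1 diff_le_self
        Nat.le_diff_conv order_refl)
  also have "card (f ` S - {v}) \<le> card T" using assms card_mono by blast
  finally show ?thesis by linarith
qed

lemma image_remove_duplicate:
  assumes "w \<in> S - {x}" "f w = f x"
  shows "f ` (S - {x}) = f ` S"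
  using assms by (auto simp: image_iff) (metis Diff_iff singletonD)

text \<open>
  Erasing a trivial letter contracts the edge that it labels, and one disc at most is lost along with the
  letter. In general the junctions at the two ends of the edge become one. If the letter is alone on its
  piece or on its boundary circle, its ends already lie at the same junction; in the first case its
  piece disappears, in the second a hole is filled in and \<open>c\<close> grows. A letter that is alone on both
  is a whole component of the surface, and erasing it may lose two discs.
\<close>
lemma diagram_delete:
  assumes D: "diagram G lab X \<sigma> \<tau> c" and x: "x \<in> X" and one: "snd (lab x) = \<one>\<^bsub>G (fst (lab x))\<^esub>"
    and ne: "\<sigma> x \<noteq> x \<or> \<tau> x \<noteq> x"
  shows "diagram G lab (X - {x}) (delete x \<sigma>) (delete x \<tau>) (if \<tau> x = x then c + 1 else c)"
proof -
  from D obtain B h d e where P: "pieces G lab X \<sigma> \<tau> B h d e"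
    and c: "c + int (card X) \<le> int (card (d ` B)) + int (card (e ` X))" by (rule diagramE)
  interpret pieces G lab X \<sigma> \<tau> B h d e by (rule P)
  have inX: "\<sigma> x \<in> X" "\<tau> x \<in> X" using s t x by (auto simp: permutes_in_image)
  \<comment> \<open>The junctions at the two ends of \<open>x\<close> get the same name.\<close>
  define e' where "e' = (\<lambda>z. if e z = e (\<sigma> x) then e x else e z)"
  have e'x: "e' (\<sigma> x) = e' x" "e' (\<tau> x) = e' x" using e[OF x] by (auto simp: e'_def)
  have e'e: "e' (\<sigma> z) = e' (\<tau> z)" if "z \<in> X" for z using e[OF that] by (auto simp: e'_def)
  have ds: "delete x \<sigma> z = (if \<sigma> z = x then \<sigma> x else \<sigma> z)" if "z \<noteq> x" for z
    using delete_apply[OF s that] .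
  have dt: "delete x \<tau> z = (if \<tau> z = x then \<tau> x else \<tau> z)" if "z \<noteq> x" for z
    using delete_apply[OF t that] .
  have card: "int (card X) = int (card (X - {x})) + 1"
    using fin x by (metis card_Suc_Diff1 of_nat_Suc add.commute)
  have finB: "finite B" using B fin finite_subset by blast
  have dB: "int (card (d ` B)) - 1 \<le> int (card (d ` (B - {x})))"
    by (rule card_image_drop[where v = "d x"]) (use finB in auto)
  have dB': "d ` B = d ` (B - {x})" if "\<sigma> x \<noteq> x"
  proof (cases "x \<in> B")
    case True
    then have "\<sigma> x \<in> B - {x}" "d (\<sigma> x) = d x" using h that by auto
    then show ?thesis using image_remove_duplicate by metis
  qed simp
  have eX: "int (card (e ` X)) - 1 \<le> int (card (e' ` (X - {x})))" if "\<sigma> x \<noteq> x"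
  proof (rule card_image_drop[where v = "e (\<sigma> x)"])
    show "e ` X - {e (\<sigma> x)} \<subseteq> e' ` (X - {x})"
    proof
      fix v assume "v \<in> e ` X - {e (\<sigma> x)}"
      then obtain z where z: "z \<in> X" "v = e z" "e z \<noteq> e (\<sigma> x)" by auto
      show "v \<in> e' ` (X - {x})"
      proof (cases "z = x")
        case True
        then have "v = e' (\<sigma> x)" using z by (simp add: e'_def)
        then show ?thesis using that inX by auto
      next
        case False
        then have "v = e' z" using z by (simp add: e'_def)
        then show ?thesis using False z by auto
      qed
    qed
  qed (use fin in auto)
  have eX': "e ` X = e' ` (X - {x})" if "w \<in> X - {x}" "e w = e x" "e (\<sigma> x) = e x" for w
  proof -
    have "e' = e" using that by (auto simp: e'_def)
    then show ?thesis using image_remove_duplicate that by metis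
  qed
  show ?thesis
  proof (rule diagramI[where B = "B - {x}" and h = h and d = d and e = e'], rule pieces.intro)
    show "delete x \<sigma> permutes X - {x}" "delete x \<tau> permutes X - {x}"
      using s t x by (auto intro: delete_permutes)
    fix z assume z: "z \<in> X - {x}"
    show "group (G (fst (lab z))) \<and> snd (lab z) \<in> carrier (G (fst (lab z))) \<and>
        fst (lab (delete x \<sigma> z)) = fst (lab z)"
      using z lab[of z] lab[OF x] ds[of z] by auto
    show "e' (delete x \<sigma> z) = e' (delete x \<tau> z)"
      using z ds[of z] dt[of z] e'x e'e[of z] by (auto split: if_splits)
  next
    fix z assume z: "z \<in> B - {x}"
    have ne': "\<sigma> x \<noteq> x" if "\<sigma> z = x" using that z permutes_inj[OF s] by (metis Diff_iff inj_eq singletonI)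
    have "h (\<sigma> x) = h x" if "x \<in> B"
      using h[OF that] lab[OF x] one by (simp add: group.is_monoid monoid.r_one)
    then show "delete x \<sigma> z \<in> B - {x} \<and> d (delete x \<sigma> z) = d z \<and> h z \<in> carrier (G (fst (lab z))) \<and>
           h (delete x \<sigma> z) = h z \<otimes>\<^bsub>G (fst (lab z))\<^esub> snd (lab z)"
      using z ds[of z] h[of z] h[of x] ne' by auto
  next
    show "(if \<tau> x = x then c + 1 else c) + int (card (X - {x}))
      \<le> int (card (d ` (B - {x}))) + int (card (e' ` (X - {x})))"
    proof (cases "\<sigma> x = x")
      case True
      then have "\<tau> x \<noteq> x" using ne by simp
      moreover have "e ` X = e' ` (X - {x})"
        using eX'[of "\<tau> x"] True e[OF x] inX calculation by auto
      ultimately show ?thesis using c card dB by simp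
    next
      case False
      show ?thesis
      proof (cases "\<tau> x = x")
        case True
        then have "e ` X = e' ` (X - {x})"
          using eX'[of "\<sigma> x"] False e[OF x] inX by auto
        then show ?thesis using c card dB' False True by simp
      next
        case F2: False
        then show ?thesis using c card dB' eX False by simp
      qed
    qed
  qed (use fin B in auto)
qed

text \<open>
  Gluing two boundary edges with inverse labels. Composing both permutations with the transposition
  leaves \<open>\<tau> \<sigma>\<^sup>-\<^sup>1\<close>, hence all junctions, unchanged. At most one disc is lost: two different discs become
  one disc, and a piece that is glued to itself or to a piece that is not a disc is given up.
\<close>
lemma diagram_swap:
  assumes D: "diagram G lab X \<sigma> \<tau> c" and x: "x \<in> X" "x' \<in> X" "x \<noteq> x'"
    and fac: "fst (lab x) = i" "fst (lab x') = i"
    and inv: "snd (lab x) \<otimes>\<^bsub>G i\<^esub> snd (lab x') = \<one>\<^bsub>G i\<^esub>"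
  shows "diagram G (lab(x := (i, \<one>\<^bsub>G i\<^esub>), x' := (i, \<one>\<^bsub>G i\<^esub>))) X
           (\<sigma> \<circ> transpose x x') (\<tau> \<circ> transpose x x') (c - 1)"
proof -
  from D obtain B h d e where P: "pieces G lab X \<sigma> \<tau> B h d e"
    and c: "c + int (card X) \<le> int (card (d ` B)) + int (card (e ` X))" by (rule diagramE)
  interpret pieces G lab X \<sigma> \<tau> B h d e by (rule P)
  interpret group "G i" using lab[OF x(1)] fac by auto
  have finB: "finite B" using B fin finite_subset by blast
  let ?t = "transpose x x'"
  let ?lab = "lab(x := (i, \<one>\<^bsub>G i\<^esub>), x' := (i, \<one>\<^bsub>G i\<^esub>))"
  have fst_lab: "fst (?lab z) = fst (lab z)" for z using fac by simp
  have tX: "?t permutes X" using x by (intro permutes_swap_id)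
  have perms: "\<sigma> \<circ> ?t permutes X" "\<tau> \<circ> ?t permutes X"
    using permutes_compose[OF tX] s t by auto
  have lab': "group (G (fst (?lab z))) \<and> snd (?lab z) \<in> carrier (G (fst (?lab z))) \<and>
        fst (?lab ((\<sigma> \<circ> ?t) z)) = fst (?lab z)" if "z \<in> X" for z
    using lab[OF that] lab[OF x(1)] lab[OF x(2)] fac unfolding fst_lab
    by (auto simp: transpose_def)
  have e': "e ((\<sigma> \<circ> ?t) z) = e ((\<tau> \<circ> ?t) z)" if "z \<in> X" for z
    using e[of "?t z"] that tX by (simp add: permutes_in_image)
  show ?thesis
  proof (cases "x \<in> B \<and> x' \<in> B \<and> d x \<noteq> d x'")
    case True
    \<comment> \<open>Left translation by \<open>a\<close> adjusts the potential on the disc of \<open>x'\<close> so that it fits the one on the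
      disc of \<open>x\<close>. The name \<open>d x'\<close> may be shared by discs over other factors, which are left alone.\<close>
    define a where "a = h x \<otimes>\<^bsub>G i\<^esub> snd (lab x) \<otimes>\<^bsub>G i\<^esub> inv\<^bsub>G i\<^esub> (h x')"
    define h' where "h' = (\<lambda>z. if d z = d x' \<and> fst (lab z) = i then a \<otimes>\<^bsub>G i\<^esub> h z else h z)"
    define d' where "d' = (\<lambda>z. if d z = d x' then d x else d z)"
    have xc: "h x \<in> carrier (G i)" "h x' \<in> carrier (G i)" "snd (lab x) \<in> carrier (G i)"
       "snd (lab x') \<in> carrier (G i)"
      using h[of x] h[of x'] True lab[OF x(1)] lab[OF x(2)] fac by auto
    have ac: "a \<in> carrier (G i)" using xc by (simp add: a_def)
    have ax': "a \<otimes>\<^bsub>G i\<^esub> h x' = h x \<otimes>\<^bsub>G i\<^esub> snd (lab x)"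
      using xc by (simp add: a_def m_assoc)
    have hx: "h (\<sigma> x) = h x \<otimes>\<^bsub>G i\<^esub> snd (lab x)" "d (\<sigma> x) = d x" "fst (lab (\<sigma> x)) = i" "\<sigma> x \<in> B"
      using h[of x] h[of x'] True lab[OF x(1)] lab[OF x(2)] fac by auto
    have hx': "h (\<sigma> x') = h x' \<otimes>\<^bsub>G i\<^esub> snd (lab x')" "d (\<sigma> x') = d x'" "fst (lab (\<sigma> x')) = i" "\<sigma> x' \<in> B"
      using h[of x] h[of x'] True lab[OF x(1)] lab[OF x(2)] fac by auto
    have asx': "a \<otimes>\<^bsub>G i\<^esub> h (\<sigma> x') = h x"
    proof -
      have "a \<otimes>\<^bsub>G i\<^esub> h (\<sigma> x') = (a \<otimes>\<^bsub>G i\<^esub> h x') \<otimes>\<^bsub>G i\<^esub> snd (lab x')"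
        using ac xc hx' by (simp add: m_assoc)
      also have "\<dots> = h x \<otimes>\<^bsub>G i\<^esub> (snd (lab x) \<otimes>\<^bsub>G i\<^esub> snd (lab x'))"
        unfolding ax' using xc by (simp add: m_assoc)
      finally show ?thesis using inv xc by simp
    qed
    show ?thesis
    proof (rule diagramI[where B = B and h = h' and d = d' and e = e], rule pieces.intro)
      fix z assume z: "z \<in> B"
      consider "z = x" | "z = x'" | "z \<noteq> x" "z \<noteq> x'" by blast
      then show "(\<sigma> \<circ> ?t) z \<in> B \<and> d' ((\<sigma> \<circ> ?t) z) = d' z \<and> h' z \<in> carrier (G (fst (?lab z))) \<and>
           h' ((\<sigma> \<circ> ?t) z) = h' z \<otimes>\<^bsub>G (fst (?lab z))\<^esub> snd (?lab z)"
      proof cases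
        case 1
        then show ?thesis using hx' asx' xc True x fac by (simp add: h'_def d'_def)
      next
        case 2
        then show ?thesis using hx ax' xc True x fac ac by (simp add: h'_def d'_def)
      next
        case 3
        have zX: "z \<in> X" using z B by auto
        have "a \<otimes>\<^bsub>G i\<^esub> h z \<in> carrier (G i)"
          "a \<otimes>\<^bsub>G i\<^esub> (h z \<otimes>\<^bsub>G i\<^esub> snd (lab z)) = a \<otimes>\<^bsub>G i\<^esub> h z \<otimes>\<^bsub>G i\<^esub> snd (lab z)"
          if "fst (lab z) = i"
          using that h[OF z] lab[OF zX] ac by (auto simp: m_assoc)
        then show ?thesis using 3 h[OF z] lab[OF zX]
          by (auto simp: h'_def d'_def)
      qed
    next
      have "int (card (d ` B)) - 1 \<le> int (card (d' ` B))"
        by (rule card_image_drop[where v = "d x'"]) (use finB in \<open>auto simp: d'_def\<close>)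
      then show "c - 1 + int (card X) \<le> int (card (d' ` B)) + int (card (e ` X))"
        using c by simp
    qed (use fin perms lab' B e' in blast)+
  next
    case False
    \<comment> \<open>Giving up the single name \<open>v\<close> removes both \<open>x\<close> and \<open>x'\<close> from the discs.\<close>
    define v where "v = (if x \<in> B then d x else d x')"
    define B' where "B' = {z \<in> B. d z \<noteq> v}"
    have nx: "x \<notin> B'" "x' \<notin> B'" using False by (auto simp: B'_def v_def)
    show ?thesis
    proof (rule diagramI[where B = B' and h = h and d = d and e = e], rule pieces.intro)
      fix z assume z: "z \<in> B'"
      then have "z \<noteq> x" "z \<noteq> x'" "z \<in> B" "d z \<noteq> v" using nx by (auto simp: B'_def)
      then show "(\<sigma> \<circ> ?t) z \<in> B' \<and> d ((\<sigma> \<circ> ?t) z) = d z \<and> h z \<in> carrier (G (fst (?lab z))) \<and>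
           h ((\<sigma> \<circ> ?t) z) = h z \<otimes>\<^bsub>G (fst (?lab z))\<^esub> snd (?lab z)"
        using h[of z] by (simp add: B'_def)
    next
      have "int (card (d ` B)) - 1 \<le> int (card (d ` B'))"
        by (rule card_image_drop[where v = v]) (use finB in \<open>auto simp: B'_def\<close>)
      then show "c - 1 + int (card X) \<le> int (card (d ` B')) + int (card (e ` X))"
        using c by simp
      show "B' \<subseteq> X" using B by (auto simp: B'_def)
    qed (use fin perms lab' e' in blast)+
  qed
qed

text \<open>
  When \<open>y'\<close> follows \<open>y\<close> both along the boundary and around the piece, the junction between them has
  no other letter, and the two letters can be multiplied.
\<close>
lemma diagram_contract:
  assumes D: "diagram G lab X \<sigma> \<tau> c" and y: "y \<in> X" "y \<noteq> y'" "\<sigma> y = y'" "\<tau> y = y'"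
  shows "diagram G (lab(y := (fst (lab y), snd (lab y) \<otimes>\<^bsub>G (fst (lab y))\<^esub> snd (lab y')))) (X - {y'})
           (delete y' \<sigma>) (delete y' \<tau>) c"
proof -
  from D obtain B h d e where P: "pieces G lab X \<sigma> \<tau> B h d e"
    and c: "c + int (card X) \<le> int (card (d ` B)) + int (card (e ` X))" by (rule diagramE)
  interpret pieces G lab X \<sigma> \<tau> B h d e by (rule P)
  let ?lab = "lab(y := (fst (lab y), snd (lab y) \<otimes>\<^bsub>G (fst (lab y))\<^esub> snd (lab y')))"
  have y'X: "y' \<in> X" using s y by (metis permutes_in_image)
  have finB: "finite B" using B fin finite_subset by blast
  interpret group "G (fst (lab y))" using lab[OF y(1)] by auto
  have fy: "fst (lab y') = fst (lab y)" using lab[OF y(1)] y by simp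
  have ni: "\<sigma> z \<noteq> y'" "\<tau> z \<noteq> y'" if "z \<noteq> y" for z
    using that y permutes_inj[OF s] permutes_inj[OF t] by (metis inj_eq)+
  have ds: "delete y' \<sigma> z = (if z = y then \<sigma> y' else \<sigma> z)" if "z \<noteq> y'" for z
    using delete_apply[OF s that] ni y by auto
  have dt: "delete y' \<tau> z = (if z = y then \<tau> y' else \<tau> z)" if "z \<noteq> y'" for z
    using delete_apply[OF t that] ni y by auto
  have card: "int (card X) = int (card (X - {y'})) + 1"
    using fin y'X by (metis card_Suc_Diff1 of_nat_Suc add.commute)
  have yB: "y \<in> B" if "y' \<in> B"
  proof -
    have "\<sigma> ` B \<subseteq> B" using h by blast
    moreover have "inj_on \<sigma> B" using permutes_inj[OF s] inj_on_subset by blast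
    ultimately have "\<sigma> ` B = B" by (rule endo_inj_surj[OF finB])
    with that have "y' \<in> \<sigma> ` B" by simp
    then obtain z where "z \<in> B" "\<sigma> z = y'" by auto
    then show ?thesis using ni(1)[of z] by (cases "z = y") simp_all
  qed
  have dB: "d ` B = d ` (B - {y'})"
  proof (cases "y' \<in> B")
    case True
    then have "y \<in> B - {y'}" "d y = d y'" using yB h[of y] y by auto
    then show ?thesis using image_remove_duplicate by metis
  qed simp
  have eX: "int (card (e ` X)) - 1 \<le> int (card (e ` (X - {y'})))"
    by (rule card_image_drop[where v = "e y'"]) (use fin in auto)
  show ?thesis
  proof (rule diagramI[where B = "B - {y'}" and h = h and d = d and e = e], rule pieces.intro)
    show "delete y' \<sigma> permutes X - {y'}" "delete y' \<tau> permutes X - {y'}"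
      using s t y'X by (auto intro: delete_permutes)
    fix z assume z: "z \<in> X - {y'}"
    show "group (G (fst (?lab z))) \<and> snd (?lab z) \<in> carrier (G (fst (?lab z))) \<and>
        fst (?lab (delete y' \<sigma> z)) = fst (?lab z)"
      using z lab[of z] lab[OF y'X] ds[of z] fy y by auto
    show "e (delete y' \<sigma> z) = e (delete y' \<tau> z)"
      using z ds[of z] dt[of z] e[of z] e[OF y'X] by auto
  next
    fix z assume z: "z \<in> B - {y'}"
    have zX: "z \<in> X" using z B by auto
    show "delete y' \<sigma> z \<in> B - {y'} \<and> d (delete y' \<sigma> z) = d z \<and> h z \<in> carrier (G (fst (?lab z))) \<and>
           h (delete y' \<sigma> z) = h z \<otimes>\<^bsub>G (fst (?lab z))\<^esub> snd (?lab z)"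
    proof (cases "z = y")
      case True
      then have b: "y' \<in> B" using h[of y] z y by auto
      have "\<sigma> y' \<noteq> y'" using ni(1)[OF y(2)[symmetric]] .
      then show ?thesis
        using True z h[OF b] h[of y] y fy lab[OF y(1)] lab[OF y'X] ds[of y] by (auto simp: m_assoc)
    next
      case False
      then show ?thesis using z h[of z] ds[of z] ni(1)[OF False] by auto
    qed
  next
    show "c + int (card (X - {y'})) \<le> int (card (d ` (B - {y'}))) + int (card (e ` (X - {y'})))"
      using c card dB eX by simp
  qed (use fin B in auto)
qed

text \<open>
  The intended use is on a boundary circle \<open>x P x' Q\<close> with \<open>P\<close> and \<open>Q\<close> nonempty: gluing \<open>x\<close> to
  \<open>x'\<close> leaves the two circles \<open>P\<close> and \<open>Q\<close>, and one hole more costs one in the Euler characteristic.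
\<close>
lemma diagram_split:
  assumes D: "diagram G lab X \<sigma> \<tau> c" and x: "x \<in> X" "x' \<in> X" "x \<noteq> x'"
    and inv: "inverse_letters G (lab x) (lab x')"
    and nx: "\<tau> x \<noteq> x" "\<tau> x \<noteq> x'" "\<tau> x' \<noteq> x" "\<tau> x' \<noteq> x'"
  shows "\<exists>\<sigma>' \<tau>'. diagram G lab (X - {x, x'}) \<sigma>' \<tau>' (c - 1) \<and>
    (\<forall>z. z \<noteq> x \<and> z \<noteq> x' \<longrightarrow> \<tau>' z = (if \<tau> z = x then \<tau> x' else if \<tau> z = x' then \<tau> x else \<tau> z))"
proof -
  define i where "i = fst (lab x)"
  let ?lab = "lab(x := (i, \<one>\<^bsub>G i\<^esub>), x' := (i, \<one>\<^bsub>G i\<^esub>))"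
  let ?\<sigma> = "\<sigma> \<circ> transpose x x'" and ?\<tau> = "\<tau> \<circ> transpose x x'"
  have D1: "diagram G ?lab X ?\<sigma> ?\<tau> (c - 1)"
    by (rule diagram_swap) (use assms in \<open>auto simp: i_def inverse_letters_def\<close>)
  have t1: "?\<tau> permutes X" using diagram_D[OF D1] by auto
  have "diagram G ?lab (X - {x}) (delete x ?\<sigma>) (delete x ?\<tau>) (if ?\<tau> x = x then c - 1 + 1 else c - 1)"
    by (rule diagram_delete[OF D1]) (use x nx in auto)
  then have D2: "diagram G ?lab (X - {x}) (delete x ?\<sigma>) (delete x ?\<tau>) (c - 1)"
    using nx by simp
  have f: "delete x ?\<tau> z = (if ?\<tau> z = x then ?\<tau> x else ?\<tau> z)" if "z \<noteq> x" for z
    using delete_apply[OF t1 that] .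
  have fx': "delete x ?\<tau> x' = \<tau> x" using f[of x'] x nx by simp
  have t2: "delete x ?\<tau> permutes X - {x}" using diagram_D[OF D2] by auto
  have "diagram G ?lab (X - {x} - {x'}) (delete x' (delete x ?\<sigma>)) (delete x' (delete x ?\<tau>))
     (if delete x ?\<tau> x' = x' then c - 1 + 1 else c - 1)"
    by (rule diagram_delete[OF D2]) (use x nx fx' in auto)
  then have D3: "diagram G ?lab (X - {x} - {x'}) (delete x' (delete x ?\<sigma>)) (delete x' (delete x ?\<tau>)) (c - 1)"
    using fx' nx by simp
  have "diagram G lab (X - {x} - {x'}) (delete x' (delete x ?\<sigma>)) (delete x' (delete x ?\<tau>)) (c - 1)"
    by (rule diagram_cong[OF D3]) auto
  moreover have "delete x' (delete x ?\<tau>) z = (if \<tau> z = x then \<tau> x' else if \<tau> z = x' then \<tau> x else \<tau> z)"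
    if "z \<noteq> x" "z \<noteq> x'" for z
    using delete_apply[OF t2 that(2)] f[OF that(1)] fx' that nx by auto
  moreover have "X - {x} - {x'} = X - {x, x'}" by auto
  ultimately show ?thesis by metis
qed

text \<open>
  Gluing the adjacent letters \<open>x\<close> and \<open>x'\<close> of a boundary circle \<open>x x' Q\<close> with \<open>Q\<close> nonempty leaves the circle
  \<open>Q\<close> and does not change the surface. If \<open>x\<close> and \<open>x'\<close> are also adjacent around their piece, gluing
  by \<open>diagram_swap\<close> would split off \<open>x'\<close> as a component of its own, and they are multiplied instead.
\<close>
lemma diagram_cancel:
  assumes D: "diagram G lab X \<sigma> \<tau> c" and x: "x \<in> X" "x' \<in> X" "x \<noteq> x'"
    and inv: "inverse_letters G (lab x) (lab x')"
    and nx: "\<tau> x = x'" "\<tau> x' \<noteq> x"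
  shows "\<exists>\<sigma>' \<tau>'. diagram G lab (X - {x, x'}) \<sigma>' \<tau>' c \<and>
    (\<forall>z. z \<noteq> x \<and> z \<noteq> x' \<longrightarrow> \<tau>' z = (if \<tau> z = x then \<tau> x' else \<tau> z))"
proof -
  define i where "i = fst (lab x)"
  have t: "\<tau> permutes X" using diagram_D[OF D] by auto
  have inj: "\<tau> z = x' \<longleftrightarrow> z = x" for z using permutes_inj[OF t] nx by (metis inj_eq)
  have XX: "X - {x'} - {x} = X - {x, x'}" by auto
  show ?thesis
  proof (cases "\<sigma> x = x'")
    case True
    let ?lab = "lab(x := (fst (lab x), snd (lab x) \<otimes>\<^bsub>G (fst (lab x))\<^esub> snd (lab x')))"
    have D1: "diagram G ?lab (X - {x'}) (delete x' \<sigma>) (delete x' \<tau>) c"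
      using diagram_contract[OF D x(1) x(3) True nx(1)] .
    have f: "delete x' \<tau> z = (if \<tau> z = x' then \<tau> x' else \<tau> z)" if "z \<noteq> x'" for z
      using delete_apply[OF t that] .
    have fx: "delete x' \<tau> x = \<tau> x'" using f[of x] x nx by simp
    have t1: "delete x' \<tau> permutes X - {x'}" using diagram_D[OF D1] by auto
    have "diagram G ?lab (X - {x'} - {x}) (delete x (delete x' \<sigma>)) (delete x (delete x' \<tau>))
        (if delete x' \<tau> x = x then c + 1 else c)"
      by (rule diagram_delete[OF D1]) (use x nx fx inv in \<open>auto simp: inverse_letters_def\<close>)
    then have D2: "diagram G ?lab (X - {x'} - {x}) (delete x (delete x' \<sigma>)) (delete x (delete x' \<tau>)) c"
      using fx nx by simp
    have "diagram G lab (X - {x'} - {x}) (delete x (delete x' \<sigma>)) (delete x (delete x' \<tau>)) c"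
      by (rule diagram_cong[OF D2]) auto
    moreover have "delete x (delete x' \<tau>) z = (if \<tau> z = x then \<tau> x' else \<tau> z)"
      if "z \<noteq> x" "z \<noteq> x'" for z
      using delete_apply[OF t1 that(1)] f[OF that(2)] fx that inj by auto
    ultimately show ?thesis using XX by metis
  next
    case False
    let ?lab = "lab(x := (i, \<one>\<^bsub>G i\<^esub>), x' := (i, \<one>\<^bsub>G i\<^esub>))"
    let ?\<sigma> = "\<sigma> \<circ> transpose x x'" and ?\<tau> = "\<tau> \<circ> transpose x x'"
    have D1: "diagram G ?lab X ?\<sigma> ?\<tau> (c - 1)"
      by (rule diagram_swap) (use assms in \<open>auto simp: i_def inverse_letters_def\<close>)
    have t1: "?\<tau> permutes X" using diagram_D[OF D1] by auto
    have "diagram G ?lab (X - {x'}) (delete x' ?\<sigma>) (delete x' ?\<tau>) (if ?\<tau> x' = x' then c - 1 + 1 else c - 1)"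
      by (rule diagram_delete[OF D1]) (use x nx False in auto)
    then have D2: "diagram G ?lab (X - {x'}) (delete x' ?\<sigma>) (delete x' ?\<tau>) c"
      using nx by simp
    have f: "delete x' ?\<tau> z = (if ?\<tau> z = x' then ?\<tau> x' else ?\<tau> z)" if "z \<noteq> x'" for z
      using delete_apply[OF t1 that] .
    have fx: "delete x' ?\<tau> x = \<tau> x'" using f[of x] x nx inj by simp
    have t2: "delete x' ?\<tau> permutes X - {x'}" using diagram_D[OF D2] by auto
    have "diagram G ?lab (X - {x'} - {x}) (delete x (delete x' ?\<sigma>)) (delete x (delete x' ?\<tau>))
       (if delete x' ?\<tau> x = x then c + 1 else c)"
      by (rule diagram_delete[OF D2]) (use x nx fx in auto)
    then have D3: "diagram G ?lab (X - {x'} - {x}) (delete x (delete x' ?\<sigma>)) (delete x (delete x' ?\<tau>)) c"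
      using fx nx by simp
    have "diagram G lab (X - {x'} - {x}) (delete x (delete x' ?\<sigma>)) (delete x (delete x' ?\<tau>)) c"
      by (rule diagram_cong[OF D3]) auto
    moreover have "delete x (delete x' ?\<tau>) z = (if \<tau> z = x then \<tau> x' else \<tau> z)"
      if "z \<noteq> x" "z \<noteq> x'" for z
      using delete_apply[OF t2 that(1)] f[OF that(2)] fx that inj by auto
    ultimately show ?thesis using XX by metis
  qed
qed

section \<open>Gluing conjugators to their inverses\<close>

abbreviation follows :: "('v \<Rightarrow> 'v) \<Rightarrow> 'v list \<Rightarrow> bool" where
  "follows \<tau> \<equiv> successively (\<lambda>a b. \<tau> a = b)"

lemma follows_avoiding:
  assumes "follows \<tau> xs" "set xs \<inter> L = {}" "\<And>z. z \<notin> L \<Longrightarrow> \<tau> z \<notin> L \<Longrightarrow> \<tau>' z = \<tau> z"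
  shows "follows \<tau>' xs"
  using assms(1) by (rule successively_mono) (use assms(2,3) in blast)

definition letters_of :: "('v \<times> 'v) list \<Rightarrow> 'v set" where
  "letters_of ps = fst ` set ps \<union> snd ` set ps"

lemma letters_of_simps [simp]:
  "letters_of [] = {}"
  "letters_of (ps @ qs) = letters_of ps \<union> letters_of qs"
  "letters_of [(x, y)] = {x, y}"
  by (auto simp: letters_of_def)

text \<open>
  The pairs in \<open>ps\<close> are glued from the inside out. The list \<open>q\<close> is the rest of the boundary circle; its
  first letter is repeated at the end to express that the circle closes up.
\<close>
lemma diagram_cancel_words:
  assumes "diagram G lab X \<sigma> \<tau> c"
    and "follows \<tau> (q @ map fst ps @ rev (map snd ps) @ [hd q])" "q \<noteq> []"
    and "distinct (q @ map fst ps @ map snd ps)" "letters_of ps \<subseteq> X"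
    and "\<forall>(x, x')\<in>set ps. inverse_letters G (lab x) (lab x')"
  shows "\<exists>\<sigma>' \<tau>'. diagram G lab (X - letters_of ps) \<sigma>' \<tau>' c \<and> follows \<tau>' (q @ [hd q]) \<and>
    (\<forall>z. z \<notin> letters_of ps \<longrightarrow> \<tau> z \<notin> letters_of ps \<longrightarrow> \<tau>' z = \<tau> z)"
  using assms
proof (induction ps arbitrary: X \<sigma> \<tau> rule: rev_induct)
  case Nil
  then show ?case by auto
next
  case (snoc p ps)
  obtain x x' where p: "p = (x, x')" by (cases p)
  let ?A = "q @ map fst ps" and ?Q = "rev (map snd ps) @ [hd q]"
  have f: "follows \<tau> (?A @ [x] @ [x'] @ ?Q)" using snoc.prems(2) p by simp
  have Q: "?Q \<noteq> []" and A: "?A \<noteq> []" using snoc.prems(3) by auto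
  have hq: "hd q \<in> set q" using snoc.prems(3) by simp
  have nA: "x \<notin> set ?A" "x' \<notin> set ?A" and nQ: "x \<notin> set ?Q" "x' \<notin> set ?Q" and "x \<noteq> x'"
    using snoc.prems(4) hq p by auto
  have tx: "\<tau> x = x'" and tx': "\<tau> x' = hd ?Q" and tA: "\<tau> (last ?A) = x"
    and fA: "follows \<tau> ?A" and fQ: "follows \<tau> ?Q"
    using f A Q by (simp_all only: successively_append_iff) auto
  have "\<tau> x' \<noteq> x" using tx' nQ Q by (metis hd_in_set)
  then obtain \<sigma>1 \<tau>1 where D1: "diagram G lab (X - {x, x'}) \<sigma>1 \<tau>1 c"
    and t1: "\<And>z. z \<noteq> x \<Longrightarrow> z \<noteq> x' \<Longrightarrow> \<tau>1 z = (if \<tau> z = x then \<tau> x' else \<tau> z)"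
    using diagram_cancel[OF snoc.prems(1), of x x'] snoc.prems(5,6) p tx \<open>x \<noteq> x'\<close> by auto
  have "follows \<tau>1 ?A"
    by (rule follows_avoiding[OF fA, of "{x, x'}"]) (use nA t1 in auto)
  moreover have "follows \<tau>1 ?Q"
    by (rule follows_avoiding[OF fQ, of "{x, x'}"]) (use nQ t1 in auto)
  moreover have "\<tau>1 (last ?A) = hd ?Q"
    using t1[of "last ?A"] nA A tA tx' by (metis last_in_set)
  ultimately have f1: "follows \<tau>1 (?A @ ?Q)"
    using successively_append_iff by blast
  have "\<exists>\<sigma>' \<tau>'. diagram G lab (X - {x, x'} - letters_of ps) \<sigma>' \<tau>' c \<and> follows \<tau>' (q @ [hd q]) \<and>
    (\<forall>z. z \<notin> letters_of ps \<longrightarrow> \<tau>1 z \<notin> letters_of ps \<longrightarrow> \<tau>' z = \<tau>1 z)"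
    by (rule snoc.IH[OF D1])
      (use snoc.prems f1 p nA nQ in \<open>auto simp: letters_of_def\<close>)
  then obtain \<sigma>' \<tau>' where D': "diagram G lab (X - {x, x'} - letters_of ps) \<sigma>' \<tau>' c"
    and f': "follows \<tau>' (q @ [hd q])"
    and t': "\<And>z. z \<notin> letters_of ps \<Longrightarrow> \<tau>1 z \<notin> letters_of ps \<Longrightarrow> \<tau>' z = \<tau>1 z" by blast
  have "X - {x, x'} - letters_of ps = X - letters_of (ps @ [p])" by (auto simp: p)
  moreover have "\<tau>' z = \<tau> z" if "z \<notin> letters_of (ps @ [p])" "\<tau> z \<notin> letters_of (ps @ [p])" for z
  proof -
    have "\<tau>1 z = \<tau> z" using that t1[of z] by (auto simp: p)
    then show ?thesis using that t'[of z] by simp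
  qed
  ultimately show ?case using D' f' by metis
qed

text \<open>
  The innermost pair splits off the circle \<open>zs\<close>; after that the remaining pairs are adjacent and
  cancel freely. This is why the Euler characteristic drops only by one, whatever the length of the
  conjugator.
\<close>
lemma diagram_split_conjugate:
  assumes D: "diagram G lab X \<sigma> \<tau> c"
    and f: "follows \<tau> (q @ map fst ps @ zs @ rev (map snd ps) @ [hd q])"
    and ne: "q \<noteq> []" "ps \<noteq> []" "zs \<noteq> []"
    and dist: "distinct (q @ map fst ps @ zs @ map snd ps)" "letters_of ps \<subseteq> X"
    and inv: "\<forall>(x, x')\<in>set ps. inverse_letters G (lab x) (lab x')"
  shows "\<exists>\<sigma>' \<tau>'. diagram G lab (X - letters_of ps) \<sigma>' \<tau>' (c - 1) \<and> follows \<tau>' (q @ [hd q]) \<and>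
    follows \<tau>' (zs @ [hd zs]) \<and>
    (\<forall>z. z \<notin> letters_of ps \<longrightarrow> \<tau> z \<notin> letters_of ps \<longrightarrow> \<tau>' z = \<tau> z)"
proof -
  obtain rs x x' where ps: "ps = rs @ [(x, x')]" using ne(2) by (metis rev_exhaust surj_pair)
  let ?A = "q @ map fst rs" and ?Q = "rev (map snd rs) @ [hd q]"
  have f: "follows \<tau> (?A @ [x] @ zs @ [x'] @ ?Q)" using f ps by simp
  have Q: "?Q \<noteq> []" and A: "?A \<noteq> []" using ne by auto
  have hq: "hd q \<in> set q" using ne by simp
  have nA: "x \<notin> set ?A" "x' \<notin> set ?A" and nQ: "x \<notin> set ?Q" "x' \<notin> set ?Q" and "x \<noteq> x'"
    and nz: "x \<notin> set zs" "x' \<notin> set zs" and lz: "letters_of rs \<inter> set zs = {}"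
    using dist(1) hq ps by (auto simp: letters_of_def)
  have tx: "\<tau> x = hd zs" and tx': "\<tau> x' = hd ?Q" and tA: "\<tau> (last ?A) = x" and tz: "\<tau> (last zs) = x'"
    and fA: "follows \<tau> ?A" and fQ: "follows \<tau> ?Q" and fz: "follows \<tau> zs"
    using f A Q ne(3) by (simp_all only: successively_append_iff) auto
  have hz: "hd zs \<in> set zs" "last zs \<in> set zs" using ne by auto
  have "\<tau> x' \<noteq> x" "\<tau> x' \<noteq> x'" using tx' nQ Q by (metis hd_in_set)+
  moreover have "\<tau> x \<noteq> x" "\<tau> x \<noteq> x'" using tx nz hz by metis+
  ultimately obtain \<sigma>1 \<tau>1 where D1: "diagram G lab (X - {x, x'}) \<sigma>1 \<tau>1 (c - 1)"
    and t1: "\<And>z. z \<noteq> x \<Longrightarrow> z \<noteq> x' \<Longrightarrow>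
      \<tau>1 z = (if \<tau> z = x then \<tau> x' else if \<tau> z = x' then \<tau> x else \<tau> z)"
    using diagram_split[OF D, of x x'] dist(2) inv ps \<open>x \<noteq> x'\<close> by auto
  have "follows \<tau>1 ?A"
    by (rule follows_avoiding[OF fA, of "{x, x'}"]) (use nA t1 in auto)
  moreover have "follows \<tau>1 ?Q"
    by (rule follows_avoiding[OF fQ, of "{x, x'}"]) (use nQ t1 in auto)
  moreover have "\<tau>1 (last ?A) = hd ?Q"
    using t1[of "last ?A"] nA A tA tx' by (metis last_in_set)
  ultimately have f1: "follows \<tau>1 (?A @ ?Q)"
    using successively_append_iff by blast
  have "follows \<tau>1 zs"
    by (rule follows_avoiding[OF fz, of "{x, x'}"]) (use nz t1 in auto)
  moreover have "\<tau>1 (last zs) = hd zs"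
  proof -
    have "last zs \<noteq> x" "last zs \<noteq> x'" using nz hz by metis+
    then show ?thesis using t1[of "last zs"] tz tx \<open>x \<noteq> x'\<close> by simp
  qed
  ultimately have f1z: "follows \<tau>1 (zs @ [hd zs])"
    by (simp add: successively_append_iff)
  have "\<exists>\<sigma>' \<tau>'. diagram G lab (X - {x, x'} - letters_of rs) \<sigma>' \<tau>' (c - 1) \<and> follows \<tau>' (q @ [hd q]) \<and>
    (\<forall>z. z \<notin> letters_of rs \<longrightarrow> \<tau>1 z \<notin> letters_of rs \<longrightarrow> \<tau>' z = \<tau>1 z)"
    by (rule diagram_cancel_words[OF D1])
      (use dist ne inv f1 ps nA nQ in \<open>auto simp: letters_of_def\<close>)
  then obtain \<sigma>' \<tau>' where D': "diagram G lab (X - {x, x'} - letters_of rs) \<sigma>' \<tau>' (c - 1)"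
    and f': "follows \<tau>' (q @ [hd q])"
    and t': "\<And>z. z \<notin> letters_of rs \<Longrightarrow> \<tau>1 z \<notin> letters_of rs \<Longrightarrow> \<tau>' z = \<tau>1 z" by blast
  have "X - {x, x'} - letters_of rs = X - letters_of ps" by (auto simp: ps)
  moreover have "\<tau>' z = \<tau> z" if "z \<notin> letters_of ps" "\<tau> z \<notin> letters_of ps" for z
  proof -
    have "\<tau>1 z = \<tau> z" using that t1[of z] by (auto simp: ps)
    then show ?thesis using that t'[of z] by (simp add: ps)
  qed
  moreover have "follows \<tau>' (zs @ [hd zs])"
    by (rule follows_avoiding[OF f1z, of "letters_of rs"]) (use lz hz t' in auto)
  ultimately show ?thesis using D' f' by metis
qed

definition conjugate_word :: "('v \<times> 'v) list \<times> 'v list \<Rightarrow> 'v list" where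
  "conjugate_word = (\<lambda>(ps, zs). map fst ps @ zs @ rev (map snd ps))"

lemma set_conjugate_word: "set (conjugate_word (ps, zs)) = letters_of ps \<union> set zs"
  by (auto simp: conjugate_word_def letters_of_def)

text \<open>
  The last conjugate is split off first, so that the rest of the circle, which contains \<open>q\<close>, is never
  empty. The final clause says that circles which have been split off are not touched again.
\<close>
lemma diagram_split_conjugates:
  assumes "diagram G lab X \<sigma> \<tau> c" "q \<noteq> []"
    and "follows \<tau> (q @ concat (map conjugate_word Cs) @ [hd q])"
    and "distinct (q @ concat (map conjugate_word Cs))"
    and "set (concat (map conjugate_word Cs)) \<subseteq> X"
    and "\<forall>(ps, zs)\<in>set Cs. ps \<noteq> [] \<and> zs \<noteq> [] \<and> (\<forall>(x, x')\<in>set ps. inverse_letters G (lab x) (lab x'))"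
  shows "\<exists>\<sigma>' \<tau>'. diagram G lab (X - (\<Union>(ps, zs)\<in>set Cs. letters_of ps)) \<sigma>' \<tau>' (c - int (length Cs)) \<and>
    follows \<tau>' (q @ [hd q]) \<and> (\<forall>(ps, zs)\<in>set Cs. follows \<tau>' (zs @ [hd zs])) \<and>
    (\<forall>z. z \<notin> (\<Union>(ps, zs)\<in>set Cs. letters_of ps) \<longrightarrow> \<tau> z \<notin> (\<Union>(ps, zs)\<in>set Cs. letters_of ps) \<longrightarrow>
       \<tau>' z = \<tau> z)"
  using assms
proof (induction Cs arbitrary: X \<sigma> \<tau> c rule: rev_induct)
  case Nil
  then show ?case by auto
next
  case (snoc C Cs)
  obtain ps zs where C: "C = (ps, zs)" by (cases C)
  let ?q = "q @ concat (map conjugate_word Cs)"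
  let ?L = "\<Union>(ps, zs)\<in>set Cs. letters_of ps"
  have hd: "hd ?q = hd q" using snoc.prems(2) by simp
  have ne: "ps \<noteq> []" "zs \<noteq> []" "\<forall>(x, x')\<in>set ps. inverse_letters G (lab x) (lab x')"
    using snoc.prems(6) by (auto simp: C)
  have dist: "distinct (?q @ map fst ps @ zs @ map snd ps)"
    using snoc.prems(4) by (auto simp: C conjugate_word_def)
  have Lq: "?L \<subseteq> set ?q" by (auto simp: set_conjugate_word)
  have lq: "letters_of ps \<inter> set ?q = {}" "set zs \<inter> set ?q = {}" "letters_of ps \<inter> set zs = {}"
    using dist by (auto simp: letters_of_def)
  have hz: "hd zs \<in> set zs" "hd q \<in> set ?q" using ne snoc.prems(2) by auto
  have "\<exists>\<sigma>' \<tau>'. diagram G lab (X - letters_of ps) \<sigma>' \<tau>' (c - 1) \<and> follows \<tau>' (?q @ [hd ?q]) \<and>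
    follows \<tau>' (zs @ [hd zs]) \<and>
    (\<forall>z. z \<notin> letters_of ps \<longrightarrow> \<tau> z \<notin> letters_of ps \<longrightarrow> \<tau>' z = \<tau> z)"
  proof (rule diagram_split_conjugate[OF snoc.prems(1) _ _ ne(1,2) dist _ ne(3)])
    show "follows \<tau> (?q @ map fst ps @ zs @ rev (map snd ps) @ [hd ?q])"
      using snoc.prems(3) unfolding hd by (simp add: C conjugate_word_def)
    show "letters_of ps \<subseteq> X" using snoc.prems(5) by (auto simp: C set_conjugate_word)
  qed (use snoc.prems(2) in auto)
  then obtain \<sigma>1 \<tau>1 where D1: "diagram G lab (X - letters_of ps) \<sigma>1 \<tau>1 (c - 1)"
    and f1: "follows \<tau>1 (?q @ [hd q])" and z1: "follows \<tau>1 (zs @ [hd zs])"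
    and t1: "\<And>z. z \<notin> letters_of ps \<Longrightarrow> \<tau> z \<notin> letters_of ps \<Longrightarrow> \<tau>1 z = \<tau> z"
    unfolding hd by blast
  have "set (concat (map conjugate_word Cs)) \<subseteq> X - letters_of ps"
    using snoc.prems(5) lq(1) by auto
  moreover have "follows \<tau>1 (q @ concat (map conjugate_word Cs) @ [hd q])" using f1 by simp
  moreover have "distinct ?q" using dist unfolding distinct_append by blast
  moreover have "\<forall>(ps, zs)\<in>set Cs. ps \<noteq> [] \<and> zs \<noteq> [] \<and>
      (\<forall>(x, x')\<in>set ps. inverse_letters G (lab x) (lab x'))" using snoc.prems(6) by simp
  ultimately obtain \<sigma>' \<tau>' where
        D': "diagram G lab (X - letters_of ps - ?L) \<sigma>' \<tau>' (c - 1 - int (length Cs))"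
    and f': "follows \<tau>' (q @ [hd q])" "\<forall>(ps, zs)\<in>set Cs. follows \<tau>' (zs @ [hd zs])"
    and t': "\<And>z. z \<notin> ?L \<Longrightarrow> \<tau>1 z \<notin> ?L \<Longrightarrow> \<tau>' z = \<tau>1 z"
    using snoc.IH[OF D1 snoc.prems(2)] by blast
  have L: "(\<Union>(ps, zs)\<in>set (Cs @ [C]). letters_of ps) = letters_of ps \<union> ?L" by (auto simp: C)
  have Xe: "X - (letters_of ps \<union> ?L) = X - letters_of ps - ?L"
    and ce: "c - int (length (Cs @ [C])) = c - 1 - int (length Cs)" by auto
  have "set (zs @ [hd zs]) \<inter> ?L = {}" using hz(1) lq(2) Lq by (simp, blast)
  then have "follows \<tau>' (zs @ [hd zs])" using t' by (rule follows_avoiding[OF z1])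
  then have "\<forall>(ps, zs)\<in>set (Cs @ [C]). follows \<tau>' (zs @ [hd zs])" using f'(2) by (simp add: C)
  moreover have "\<forall>z. z \<notin> letters_of ps \<union> ?L \<longrightarrow> \<tau> z \<notin> letters_of ps \<union> ?L \<longrightarrow> \<tau>' z = \<tau> z"
    using t1 t' by simp
  ultimately show ?case using D' f'(1) unfolding L Xe ce by blast
qed

section \<open>The diagram of a word that represents the identity\<close>

text \<open>
  The new letter is balanced by a new disc, which it bounds alone.
\<close>
lemma diagram_insert_trivial:
  assumes D: "diagram G lab X \<sigma> \<tau> c" and p: "p \<in> X" and z: "z \<notin> X"
    and G: "group (G (fst (lab z)))" and one: "snd (lab z) = \<one>\<^bsub>G (fst (lab z))\<^esub>"
  shows "diagram G lab (insert z X) \<sigma> (\<tau> \<circ> transpose p z) c"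
proof -
  from D obtain B h d e where P: "pieces G lab X \<sigma> \<tau> B h d e"
    and c: "c + int (card X) \<le> int (card (d ` B)) + int (card (e ` X))" by (rule diagramE)
  interpret pieces G lab X \<sigma> \<tau> B h d e by (rule P)
  interpret Gz: group "G (fst (lab z))" by (rule G)
  have zB: "z \<notin> B" using B z by auto
  have finB: "finite B" using B fin finite_subset by blast
  obtain v where v: "v \<notin> d ` B" using finB ex_new_if_finite infinite_UNIV_nat by (metis finite_imageI)
  have sz: "\<sigma> z = z" and tz: "\<tau> z = z" using s t z by (auto intro: permutes_not_in)
  have sX: "\<sigma> w \<in> X" and tX: "\<tau> w \<in> X" if "w \<in> X" for w
    using s t that by (auto simp: permutes_in_image)
  have dB: "(d(z := v)) ` insert z B = insert v (d ` B)" using zB by auto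
  have eX: "(e(z := e (\<tau> p))) ` insert z X = e ` X" using z tX[OF p] by (auto simp: image_iff)
  show ?thesis
  proof (rule diagramI[where B = "insert z B" and h = "h(z := \<one>\<^bsub>G (fst (lab z))\<^esub>)"
        and d = "d(z := v)" and e = "e(z := e (\<tau> p))"], rule pieces.intro)
    have st: "\<sigma> permutes insert z X" "\<tau> permutes insert z X"
      using s t by (auto intro: permutes_subset)
    moreover have "transpose p z permutes insert z X" using p by (intro permutes_swap_id) auto
    ultimately show "\<sigma> permutes insert z X" "\<tau> \<circ> transpose p z permutes insert z X"
      by (auto intro: permutes_compose)
    fix w assume w: "w \<in> insert z X"
    show "group (G (fst (lab w))) \<and> snd (lab w) \<in> carrier (G (fst (lab w))) \<and>
      fst (lab (\<sigma> w)) = fst (lab w)"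
      using w lab[of w] G one sz by auto
    show "(e(z := e (\<tau> p))) (\<sigma> w) = (e(z := e (\<tau> p))) ((\<tau> \<circ> transpose p z) w)"
    proof -
      consider "w = z" | "w = p" | "w \<in> X" "w \<noteq> z" "w \<noteq> p" using w by blast
      then show ?thesis
      proof cases
        case 1
        then show ?thesis using sz by simp
      next
        case 2
        then show ?thesis using sX[OF p] z e[OF p] tz by auto
      next
        case 3
        then show ?thesis using sX[of w] tX[of w] z e[of w] by auto
      qed
    qed
  next
    fix w assume w: "w \<in> insert z B"
    show "\<sigma> w \<in> insert z B \<and> (d(z := v)) (\<sigma> w) = (d(z := v)) w \<and>
      (h(z := \<one>\<^bsub>G (fst (lab z))\<^esub>)) w \<in> carrier (G (fst (lab w))) \<and>
      (h(z := \<one>\<^bsub>G (fst (lab z))\<^esub>)) (\<sigma> w) =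
      (h(z := \<one>\<^bsub>G (fst (lab z))\<^esub>)) w \<otimes>\<^bsub>G (fst (lab w))\<^esub> snd (lab w)"
    proof (cases "w = z")
      case True
      then show ?thesis using sz one by simp
    next
      case False
      then have "w \<in> B" using w by simp
      then show ?thesis using False h[of w] zB by auto
    qed
  next
    show "c + int (card (insert z X)) \<le>
      int (card ((d(z := v)) ` insert z B)) + int (card ((e(z := e (\<tau> p))) ` insert z X))"
      unfolding dB eX using c v z fin finB by simp
  qed (use fin B in auto)
qed

text \<open>
  The inverse of \<open>diagram_contract\<close>: the new junction between the two letters balances the new
  letter.
\<close>
lemma diagram_expand:
  assumes D: "diagram G (lab(y := (i, a \<otimes>\<^bsub>G i\<^esub> b))) X \<sigma> \<tau> c" and y: "y \<in> X" and z: "z \<notin> X"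
    and ab: "lab y = (i, a)" "lab z = (i, b)" "a \<in> carrier (G i)" "b \<in> carrier (G i)"
  shows "diagram G lab (insert z X) (\<sigma> \<circ> transpose y z) (\<tau> \<circ> transpose y z) c"
proof -
  let ?lab = "lab(y := (i, a \<otimes>\<^bsub>G i\<^esub> b))"
  from D obtain B h d e where P: "pieces G ?lab X \<sigma> \<tau> B h d e"
    and c: "c + int (card X) \<le> int (card (d ` B)) + int (card (e ` X))" by (rule diagramE)
  interpret pieces G ?lab X \<sigma> \<tau> B h d e by (rule P)
  have zB: "z \<notin> B" using B z by auto
  have yz: "y \<noteq> z" using y z by auto
  have finB: "finite B" using B fin finite_subset by blast
  interpret Gi: group "G i" using lab[OF y] by auto
  obtain v where v: "v \<notin> e ` X" using fin ex_new_if_finite infinite_UNIV_nat by (metis finite_imageI)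
  have sz: "\<sigma> z = z" and tz: "\<tau> z = z" using s t z by (auto intro: permutes_not_in)
  have sX: "\<sigma> w \<in> X" and tX: "\<tau> w \<in> X" if "w \<in> X" for w
    using s t that by (auto simp: permutes_in_image)
  have sXz: "\<sigma> w \<noteq> z" "\<tau> w \<noteq> z" if "w \<in> X" for w using sX[OF that] tX[OF that] z by auto
  define B' where "B' = (if y \<in> B then insert z B else B)"
  have dB: "(d(z := d y)) ` B' = d ` B" using zB by (auto simp: B'_def image_iff)
  have eX: "(e(z := v)) ` insert z X = insert v (e ` X)" using z by auto
  have fst_lab: "fst (lab w) = fst (?lab w)" for w using ab by simp
  have fac: "fst (lab (\<sigma> w)) = fst (lab w)" if "w \<in> X" for w
    using lab[OF that] unfolding fst_lab by blast
  show ?thesis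
  proof (rule diagramI[where B = B' and h = "h(z := h y \<otimes>\<^bsub>G i\<^esub> a)"
        and d = "d(z := d y)" and e = "e(z := v)"], rule pieces.intro)
    have st: "\<sigma> permutes insert z X" "\<tau> permutes insert z X"
      using s t by (auto intro: permutes_subset)
    moreover have "transpose y z permutes insert z X" using y by (intro permutes_swap_id) auto
    ultimately show "\<sigma> \<circ> transpose y z permutes insert z X" "\<tau> \<circ> transpose y z permutes insert z X"
      by (auto intro: permutes_compose)
    fix w assume w: "w \<in> insert z X"
    consider "w = z" | "w = y" | "w \<in> X" "w \<noteq> z" "w \<noteq> y" using w by blast
    note w_cases = this
    show "group (G (fst (lab w))) \<and> snd (lab w) \<in> carrier (G (fst (lab w))) \<and>
      fst (lab ((\<sigma> \<circ> transpose y z) w)) = fst (lab w)"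
      using w_cases
    proof cases
      case 1
      then show ?thesis using ab fac[OF y] Gi.is_group by simp
    next
      case 2
      then show ?thesis using ab sz Gi.is_group by simp
    next
      case 3
      then show ?thesis using lab[of w] fac[of w] by simp
    qed
    show "(e(z := v)) ((\<sigma> \<circ> transpose y z) w) = (e(z := v)) ((\<tau> \<circ> transpose y z) w)"
      using w_cases
    proof cases
      case 1
      then show ?thesis using sXz[OF y] e[OF y] by simp
    next
      case 2
      then show ?thesis using sz tz by simp
    next
      case 3
      then show ?thesis using sXz[of w] e[of w] by simp
    qed
  next
    fix w assume w: "w \<in> B'"
    consider "w = z" "y \<in> B" | "w = y" "y \<in> B" | "w \<in> B" "w \<in> X" "w \<noteq> z" "w \<noteq> y"
      using w B zB by (auto simp: B'_def split: if_splits)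
    then show "(\<sigma> \<circ> transpose y z) w \<in> B' \<and> (d(z := d y)) ((\<sigma> \<circ> transpose y z) w) = (d(z := d y)) w \<and>
      (h(z := h y \<otimes>\<^bsub>G i\<^esub> a)) w \<in> carrier (G (fst (lab w))) \<and>
      (h(z := h y \<otimes>\<^bsub>G i\<^esub> a)) ((\<sigma> \<circ> transpose y z) w) =
      (h(z := h y \<otimes>\<^bsub>G i\<^esub> a)) w \<otimes>\<^bsub>G (fst (lab w))\<^esub> snd (lab w)"
    proof cases
      case 1
      then show ?thesis using h[of y] ab sXz[OF y] by (simp add: B'_def Gi.m_assoc)
    next
      case 2
      then show ?thesis using h[of y] ab sz yz by (simp add: B'_def)
    next
      case 3
      then show ?thesis using h[of w] sXz[of w] by (simp add: B'_def)
    qed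
  next
    show "c + int (card (insert z X)) \<le>
      int (card ((d(z := d y)) ` B')) + int (card ((e(z := v)) ` insert z X))"
      unfolding dB eX using c v z fin by simp
    show "B' \<subseteq> insert z X" using B by (auto simp: B'_def)
  qed (use fin in auto)
qed

lemma follows_cong_butlast:
  "follows \<tau> xs \<Longrightarrow> (\<And>a. a \<in> set (butlast xs) \<Longrightarrow> \<tau>' a = \<tau> a) \<Longrightarrow> follows \<tau>' xs"
  by (induction xs rule: induct_list012) auto

lemma follows_insert:
  assumes f: "follows \<tau> (A @ p # C)" and C: "C \<noteq> []"
    and p: "p \<notin> set A" "p \<notin> set (butlast C)" and z: "z \<notin> set A" "z \<notin> set (butlast C)" "\<tau> z = z"
  shows "follows (\<tau> \<circ> transpose p z) (A @ p # z # C)"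
proof -
  let ?t = "\<tau> \<circ> transpose p z"
  have "follows \<tau> (A @ [p])" "follows \<tau> C" "\<tau> p = hd C"
    using f C by (auto simp: successively_append_iff successively_Cons)
  moreover have "follows ?t (A @ [p])"
    using \<open>follows \<tau> (A @ [p])\<close> by (rule follows_cong_butlast) (use p z in \<open>auto simp: transpose_def\<close>)
  moreover have "follows ?t C"
    using \<open>follows \<tau> C\<close> by (rule follows_cong_butlast) (use p z in \<open>auto simp: transpose_def\<close>)
  ultimately show ?thesis using z(3) by (auto simp: successively_append_iff successively_Cons)
qed

lemma not_successively_split:
  "\<not> successively P xs \<Longrightarrow> \<exists>l1 a b l2. xs = l1 @ a # b # l2 \<and> \<not> P a b"
proof (induction xs rule: induct_list012)
  case (3 x y zs)
  show ?case
  proof (cases "P x y")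
    case True
    then obtain l1 a b l2 where "y # zs = l1 @ a # b # l2" "\<not> P a b" using 3 by auto
    then show ?thesis by (metis append_Cons)
  next
    case False
    then show ?thesis by (metis append_Nil)
  qed
qed auto

text \<open>
  A word that represents the identity bounds a disc, of Euler characteristic \<open>1\<close>. By induction on its
  length: unless the word is a single trivial letter, it contains a trivial letter or two adjacent
  letters in the same factor, as otherwise it would be a nonempty reduced word. Removing the
  letter or multiplying the two letters gives a shorter word, and its diagram is expanded.
\<close>
lemma diagram_of_trivial_word:
  assumes G: "\<And>i. i \<in> I \<Longrightarrow> group (G i)"
  shows "l \<noteq> [] \<Longrightarrow> distinct l \<Longrightarrow> \<forall>z\<in>set l. valid_letter I G (lab z) \<Longrightarrow>
    foldr (syllable_mult G) (map lab l) [] = [] \<Longrightarrow>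
    \<exists>\<sigma> \<tau>. diagram G lab (set l) \<sigma> \<tau> 1 \<and> follows \<tau> (l @ [hd l])"
proof (induction l arbitrary: lab rule: length_induct)
  case (1 l)
  note IH = 1(1)[rule_format] and prems = 1(2-)
  show ?case
  proof (cases "\<exists>z\<in>set l. snd (lab z) = \<one>\<^bsub>G (fst (lab z))\<^esub>")
    case True
    then obtain z l1 l2 where z: "snd (lab z) = \<one>\<^bsub>G (fst (lab z))\<^esub>" and l: "l = l1 @ z # l2"
      by (metis split_list)
    have Gz: "group (G (fst (lab z)))" using prems(3) G l by (auto simp: valid_letter_def)
    interpret group "G (fst (lab z))" by (rule Gz)
    show ?thesis
    proof (cases "l1 @ l2 = []")
      case True
      have "diagram G lab {z} (\<lambda>a. a) (\<lambda>a. a) 1"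
        by (rule diagramI[where B = "{z}" and h = "\<lambda>_. \<one>\<^bsub>G (fst (lab z))\<^esub>"
            and d = "\<lambda>_. 0" and e = "\<lambda>_. 0"], rule pieces.intro)
          (use z Gz in \<open>auto simp: permutes_id[unfolded id_def]\<close>)
      then show ?thesis using True l by (intro exI[of _ "\<lambda>a. a"]) auto
    next
      case False
      have lz: "lab z = (fst (lab z), \<one>\<^bsub>G (fst (lab z))\<^esub>)" using z by (metis prod.collapse)
      have "syllable_mult G (lab z) w = w" for w using syllable_mult_one[of G "fst (lab z)"] lz by metis
      then have "foldr (syllable_mult G) (map lab (l1 @ l2)) [] = []" using prems(4) l by simp
      then have "\<exists>\<sigma> \<tau>. diagram G lab (set (l1 @ l2)) \<sigma> \<tau> 1 \<and> follows \<tau> ((l1 @ l2) @ [hd (l1 @ l2)])"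
        by (intro IH) (use False l prems in auto)
      then obtain \<sigma> \<tau> where D: "diagram G lab (set (l1 @ l2)) \<sigma> \<tau> 1"
        and f: "follows \<tau> ((l1 @ l2) @ [hd (l1 @ l2)])" by blast
      have nz: "z \<notin> set (l1 @ l2)" "distinct (l1 @ l2)" using prems(2) l by auto
      have tz: "\<tau> z = z" using diagram_D(3)[OF D] nz(1) by (rule permutes_not_in)
      \<comment> \<open>The cyclic predecessor of \<open>z\<close>, which is the last letter of the word if \<open>z\<close> is the first.\<close>
      define p where "p = (if l1 = [] then last l2 else last l1)"
      have p: "p \<in> set (l1 @ l2)" using False by (auto simp: p_def)
      have D': "diagram G lab (insert z (set (l1 @ l2))) \<sigma> (\<tau> \<circ> transpose p z) 1"
        by (rule diagram_insert_trivial[OF D p nz(1) Gz z])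
      have "follows (\<tau> \<circ> transpose p z) (l @ [hd l])"
      proof (cases "l1 = []")
        case True
        then have ne: "l2 \<noteq> []" using False by simp
        define A where "A = butlast l2"
        have l2: "l2 = A @ [p]" using ne True by (simp add: A_def p_def)
        have "follows (\<tau> \<circ> transpose p z) (A @ p # z # [hd l2])"
          by (rule follows_insert) (use f True nz l2 tz in auto)
        then have "follows (\<tau> \<circ> transpose p z) (l2 @ [z])" "(\<tau> \<circ> transpose p z) z = hd l2"
          using ne l2 by (auto simp: successively_append_iff successively_Cons)
        then show ?thesis using l True ne by (simp add: successively_Cons)
      next
        case l1: False
        define A where "A = butlast l1"
        have l1': "l1 = A @ [p]" using l1 by (simp add: A_def p_def)
        have "follows (\<tau> \<circ> transpose p z) (A @ p # z # l2 @ [hd l1])"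
        proof (rule follows_insert)
          show "follows \<tau> (A @ p # l2 @ [hd l1])" using f l1' by (cases A) auto
        qed (use nz l1' tz in auto)
        then show ?thesis using l l1' by (cases A) auto
      qed
      moreover have "insert z (set (l1 @ l2)) = set l" using l by auto
      ultimately show ?thesis using D' by metis
    qed
  next
    case nontriv: False
    have "\<not> distinct_adj (map fst (map lab l))"
    proof
      assume "distinct_adj (map fst (map lab l))"
      then have "map lab l \<in> reduced_words I G"
        using nontriv prems(3) by (auto simp: reduced_words_def valid_letter_def)
      then have "map lab l = []" using foldr_syllable_mult_Nil prems(4) by metis
      then show False using prems(1) by simp
    qed
    then have "\<not> successively (\<lambda>a b. fst (lab a) \<noteq> fst (lab b)) l"
      by (simp add: distinct_adj_def successively_map)
    then obtain l1 y z l2 where l: "l = l1 @ y # z # l2" and yz: "fst (lab y) = fst (lab z)"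
      using not_successively_split by blast
    define i a b where "i = fst (lab y)" and "a = snd (lab y)" and "b = snd (lab z)"
    have ly: "lab y = (i, a)" "lab z = (i, b)" using yz by (simp_all add: prod_eq_iff i_def a_def b_def)
    have ab: "i \<in> I" "a \<in> carrier (G i)" "b \<in> carrier (G i)"
      using prems(3) l ly by (auto simp: valid_letter_def)
    interpret group "G i" using G ab by auto
    let ?lab = "lab(y := (i, a \<otimes>\<^bsub>G i\<^esub> b))" and ?l = "l1 @ y # l2"
    have dist: "distinct ?l" "z \<notin> set ?l" "y \<notin> set l1" "y \<notin> set l2" using prems(2) l by auto
    let ?w = "foldr (syllable_mult G) (map lab l2) []"
    have w: "?w \<in> reduced_words I G"
      by (rule foldr_syllable_mult_valid[OF G]) (use prems(3) l in auto)
    have map_lab: "map ?lab l1 = map lab l1" "map ?lab l2 = map lab l2" using dist by auto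
    have "foldr (syllable_mult G) (map ?lab ?l) [] =
      foldr (syllable_mult G) (map lab l1) (syllable_mult G (i, a \<otimes>\<^bsub>G i\<^esub> b) ?w)"
      unfolding map_append list.map map_lab by simp
    also have "\<dots> = foldr (syllable_mult G) (map lab l) []"
      using syllable_mult_mult[OF G ab w] l ly by simp
    finally have "foldr (syllable_mult G) (map ?lab ?l) [] = []" using prems(4) by simp
    then have "\<exists>\<sigma> \<tau>. diagram G ?lab (set ?l) \<sigma> \<tau> 1 \<and> follows \<tau> (?l @ [hd ?l])"
      by (intro IH) (use l prems ab dist in \<open>auto simp: valid_letter_def\<close>)
    then obtain \<sigma> \<tau> where D: "diagram G ?lab (set ?l) \<sigma> \<tau> 1" and f: "follows \<tau> (?l @ [hd ?l])" by blast
    have tz: "\<tau> z = z" using diagram_D(3)[OF D] dist(2) by (rule permutes_not_in)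
    have D': "diagram G lab (insert z (set ?l)) (\<sigma> \<circ> transpose y z) (\<tau> \<circ> transpose y z) 1"
      by (rule diagram_expand[where i = i and a = a and b = b]) (use D dist ly ab in auto)
    have "follows (\<tau> \<circ> transpose y z) (l1 @ y # z # l2 @ [hd ?l])"
      by (rule follows_insert) (use f dist tz in auto)
    moreover have "hd ?l = hd l" using l by (cases l1) auto
    moreover have "insert z (set ?l) = set l" using l by auto
    ultimately show ?thesis using D' l by (metis append_Cons append_assoc)
  qed
qed

section \<open>Counting discs\<close>

text \<open>
  The total charge around a closed walk on the integers modulo \<open>m\<close> is a multiple of \<open>m\<close>.
\<close>
lemma sum_mod_ge:
  fixes a b :: "'v \<Rightarrow> int"
  assumes fin: "finite S" and sum: "sum a S = sum b S" and m: "0 < m"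
    and z: "z \<in> S" "(a z - b z) mod m \<noteq> 0"
  shows "m \<le> (\<Sum>z\<in>S. (a z - b z) mod m)"
proof -
  have "(\<Sum>z\<in>S. (a z - b z) mod m) mod m = (\<Sum>z\<in>S. a z - b z) mod m"
    by (rule mod_sum_eq)
  also have "\<dots> = 0" using sum by (simp add: sum_subtractf)
  finally have "m dvd (\<Sum>z\<in>S. (a z - b z) mod m)" by auto
  moreover have "0 < (\<Sum>z\<in>S. (a z - b z) mod m)"
  proof (rule sum_pos2[OF fin z(1)])
    show "0 < (a z - b z) mod m"
      using z(2) m pos_mod_sign[of m "a z - b z"] by linarith
    show "0 \<le> (a w - b w) mod m" if "w \<in> S" for w using m by simp
  qed
  ultimately show ?thesis by (rule zdvd_imp_le)
qed

lemma card_image_times_le_sum: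
  fixes w :: "'v \<Rightarrow> int"
  assumes "finite S" "\<And>k. k \<in> f ` S \<Longrightarrow> m \<le> (\<Sum>z\<in>{z \<in> S. f z = k}. w z)"
  shows "m * int (card (f ` S)) \<le> sum w S"
proof -
  have "m * int (card (f ` S)) = (\<Sum>k\<in>f ` S. m)" by simp
  also have "\<dots> \<le> (\<Sum>k\<in>f ` S. \<Sum>z\<in>{z \<in> S. f z = k}. w z)"
    using assms(2) by (rule sum_mono)
  also have "\<dots> = sum w S" using sum.image_gen[OF assms(1), of w f] by simp
  finally show ?thesis .
qed

lemma mod_complement:
  fixes D m :: int
  assumes "0 < m"
  shows "D mod m + (- D - 1) mod m = m - 1"
proof -
  have "(- D - 1) mod m = (- (D mod m) - 1) mod m"
    by (metis mod_diff_left_eq mod_minus_eq)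
  also have "\<dots> = (m - 1 - D mod m) mod m"
    by (metis (no_types, opaque_lifting) add.commute diff_add_eq minus_diff_commute mod_add_self1 uminus_add_conv_diff)
  also have "\<dots> = m - 1 - D mod m"
    using pos_mod_bound[OF assms, of D] pos_mod_sign[OF assms, of D] by (intro mod_pos_pos_trivial) auto
  finally show ?thesis by simp
qed

text \<open>
  The counting argument, with charges \<open>\<alpha>\<close> around the pieces and \<open>\<beta>\<close> around the junctions. Every disc and
  every junction is charged at least \<open>m\<close>, while a letter is charged only \<open>m - 1\<close> altogether.
\<close>
lemma diagram_bound:
  fixes g :: "('i \<times> 'a) list"
  assumes D: "diagram G lab X \<sigma> \<tau> c"
    and lab_g: "\<And>z. z \<in> X \<Longrightarrow> pos z < length g \<and> lab z = g ! pos z \<and> pos (\<tau> z) = Suc (pos z) mod length g"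
    and tf: "\<And>p. p < length g \<Longrightarrow> torsion_free (G (fst (g ! p))) \<and> snd (g ! p) \<noteq> \<one>\<^bsub>G (fst (g ! p))\<^esub>"
    and cyc: "\<And>p. p < length g \<Longrightarrow> fst (g ! p) \<noteq> fst (g ! (Suc p mod length g))"
    and ne: "g \<noteq> []"
  shows "int (length g) * (c + int (card X)) \<le> (int (length g) - 1) * int (card X)"
proof -
  from D obtain B h d e where P: "pieces G lab X \<sigma> \<tau> B h d e"
    and c: "c + int (card X) \<le> int (card (d ` B)) + int (card (e ` X))" by (rule diagramE)
  interpret pieces G lab X \<sigma> \<tau> B h d e by (rule P)
  define m where "m = int (length g)"
  have m: "0 < m" using ne by (simp add: m_def)
  define \<alpha> where "\<alpha> = (\<lambda>z. (int (pos z) - int (pos (\<sigma> z))) mod m)"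
  define \<beta> where "\<beta> = (\<lambda>z. (int (pos (\<sigma> z)) - int (pos (\<tau> z))) mod m)"
  have finB: "finite B" using B fin finite_subset by blast
  have sX: "\<sigma> z \<in> X" "\<tau> z \<in> X" if "z \<in> X" for z
    using s t that by (auto simp: permutes_in_image)
  have injs: "inj_on \<sigma> S" "inj_on \<tau> S" for S
    using permutes_inj[OF s] permutes_inj[OF t] inj_on_subset by blast+
  have pos_eq: "pos z = pos w" if "z \<in> X" "w \<in> X" "(int (pos z) - int (pos w)) mod m = 0" for z w
  proof -
    have "int (pos z) mod m = int (pos w) mod m" using that(3) by (metis mod_eq_dvd_iff mod_0_imp_dvd)
    then show ?thesis using lab_g[OF that(1)] lab_g[OF that(2)] by (simp add: m_def)
  qed
  have "m * int (card (d ` B)) \<le> sum \<alpha> B"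
  proof (rule card_image_times_le_sum[OF finB])
    fix k assume "k \<in> d ` B"
    then obtain z where z: "z \<in> B" "d z = k" by auto
    define S where "S = {z \<in> B. d z = k}"
    have finS: "finite S" and zS: "z \<in> S" using finB z by (auto simp: S_def)
    have "\<sigma> ` S \<subseteq> S" using h unfolding S_def by blast
    then have "\<sigma> ` S = S" by (rule endo_inj_surj[OF finS _ injs(1)])
    then have sum: "(\<Sum>z\<in>S. int (pos z)) = (\<Sum>z\<in>S. int (pos (\<sigma> z)))"
      using sum.reindex[OF injs(1), of "\<lambda>z. int (pos z)" S] by simp
    have "\<exists>w\<in>S. \<alpha> w \<noteq> 0"
    proof (rule ccontr)
      assume "\<not> ?thesis"
      then have z0: "\<alpha> w = 0" if "w \<in> S" for w using that by blast
      \<comment> \<open>Zero charge keeps the position constant around the cycle of \<open>z\<close>, so the potential grows by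
        the same element in every step until the cycle closes.\<close>
      let ?p = "pos z"
      let ?i = "fst (g ! ?p)" and ?a = "snd (g ! ?p)"
      have zX: "z \<in> X" using z B by auto
      have p: "?p < length g" and lz: "lab z = g ! ?p" using lab_g[OF zX] by auto
      interpret Gi: group "G ?i" using lab[OF zX] lz by auto
      have a: "?a \<in> carrier (G ?i)" using lab[OF zX] lz by auto
      have hz: "h z \<in> carrier (G ?i)" using h[OF z(1)] lz by auto
      have it: "(\<sigma> ^^ r) z \<in> S \<and> pos ((\<sigma> ^^ r) z) = ?p \<and> h ((\<sigma> ^^ r) z) = h z \<otimes>\<^bsub>G ?i\<^esub> ?a [^]\<^bsub>G ?i\<^esub> r"
        for r :: nat
      proof (induction r)
        case 0
        then show ?case using zS hz by simp
      next
        case (Suc r)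
        let ?w = "(\<sigma> ^^ r) z"
        have w: "?w \<in> S" "pos ?w = ?p" "?w \<in> B" "?w \<in> X" using Suc B by (auto simp: S_def)
        have sw: "\<sigma> ?w \<in> S" using w(1) \<open>\<sigma> ` S = S\<close> by blast
        have lw: "lab ?w = g ! ?p" using lab_g[OF w(4)] w(2) by simp
        have "pos ?w = pos (\<sigma> ?w)"
          using pos_eq[OF w(4) sX(1)[OF w(4)]] z0[OF w(1)] by (simp add: \<alpha>_def)
        moreover have "h (\<sigma> ?w) = h ?w \<otimes>\<^bsub>G ?i\<^esub> ?a" using h[OF w(3)] lw by simp
        then have "h (\<sigma> ?w) = h z \<otimes>\<^bsub>G ?i\<^esub> ?a [^]\<^bsub>G ?i\<^esub> Suc r"
          using Suc hz a by (simp add: Gi.m_assoc)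
        ultimately show ?case using sw w by simp
      qed
      have "permutation \<sigma>" using s fin by (rule permutes_imp_permutation[rotated])
      then obtain r where r: "\<sigma> ^^ r = id" "0 < r" using permutation_is_nilpotent by blast
      have "h z = h z \<otimes>\<^bsub>G ?i\<^esub> ?a [^]\<^bsub>G ?i\<^esub> r" using it[of r] r by simp
      then have "?a [^]\<^bsub>G ?i\<^esub> r = \<one>\<^bsub>G ?i\<^esub>" using hz a by simp
      then show False using tf[OF p] r(2) a unfolding torsion_free_def by blast
    qed
    then show "m \<le> sum \<alpha> {z \<in> B. d z = k}"
      using sum_mod_ge[OF finS sum m] unfolding S_def \<alpha>_def by blast
  qed
  also have "sum \<alpha> B \<le> sum \<alpha> X"
    using fin B m by (intro sum_mono2) (auto simp: \<alpha>_def)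
  finally have 1: "m * int (card (d ` B)) \<le> sum \<alpha> X" .
  have "e ` X = (\<lambda>z. e (\<sigma> z)) ` X" using permutes_image[OF s] by (metis image_image)
  then have "m * int (card (e ` X)) = m * int (card ((\<lambda>z. e (\<sigma> z)) ` X))" by simp
  also have "\<dots> \<le> sum \<beta> X"
  proof (rule card_image_times_le_sum[OF fin])
    fix k assume "k \<in> (\<lambda>z. e (\<sigma> z)) ` X"
    then obtain z where z: "z \<in> X" "e (\<sigma> z) = k" by auto
    define S where "S = {z \<in> X. e (\<sigma> z) = k}"
    have finS: "finite S" and zS: "z \<in> S" using fin z by (auto simp: S_def)
    have im: "\<sigma> ` S = {y \<in> X. e y = k}"
    proof
      show "{y \<in> X. e y = k} \<subseteq> \<sigma> ` S"
      proof
        fix y assume y: "y \<in> {y \<in> X. e y = k}"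
        then obtain w where "w \<in> X" "y = \<sigma> w" using permutes_image[OF s] by blast
        then show "y \<in> \<sigma> ` S" using y by (auto simp: S_def)
      qed
    qed (use sX in \<open>auto simp: S_def\<close>)
    have "\<tau> ` S = {y \<in> X. e y = k}"
    proof
      show "{y \<in> X. e y = k} \<subseteq> \<tau> ` S"
      proof
        fix y assume y: "y \<in> {y \<in> X. e y = k}"
        then obtain w where "w \<in> X" "y = \<tau> w" using permutes_image[OF t] by blast
        then show "y \<in> \<tau> ` S" using y e by (auto simp: S_def)
      qed
    qed (use sX e in \<open>auto simp: S_def\<close>)
    then have sum: "(\<Sum>z\<in>S. int (pos (\<sigma> z))) = (\<Sum>z\<in>S. int (pos (\<tau> z)))"
      using im sum.reindex[OF injs(1), of "\<lambda>z. int (pos z)" S]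
        sum.reindex[OF injs(2), of "\<lambda>z. int (pos z)" S] by simp
    \<comment> \<open>\<open>\<sigma>\<close> preserves the factor, whereas cyclically adjacent syllables of \<open>g\<close> lie in different ones.\<close>
    have "\<beta> z \<noteq> 0"
    proof
      assume "\<beta> z = 0"
      then have "pos (\<sigma> z) = Suc (pos z) mod length g"
        using pos_eq[OF sX(1)[OF z(1)] sX(2)[OF z(1)]] lab_g[OF z(1)] by (simp add: \<beta>_def)
      then have "fst (g ! (Suc (pos z) mod length g)) = fst (g ! pos z)"
        using lab[OF z(1)] lab_g[OF z(1)] lab_g[OF sX(1)[OF z(1)]] by simp
      then show False using cyc[of "pos z"] lab_g[OF z(1)] by simp
    qed
    then show "m \<le> sum \<beta> {z \<in> X. e (\<sigma> z) = k}"
      using sum_mod_ge[OF finS sum m zS] unfolding S_def \<beta>_def by blast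
  qed
  finally have 2: "m * int (card (e ` X)) \<le> sum \<beta> X" .
  have "\<alpha> z + \<beta> z = m - 1" if z: "z \<in> X" for z
  proof -
    have "int (pos (\<tau> z)) = (int (pos z) + 1) mod m"
      using lab_g[OF z] by (simp add: m_def zmod_int add.commute)
    then have "\<beta> z = (int (pos (\<sigma> z)) - (int (pos z) + 1)) mod m"
      by (simp add: \<beta>_def mod_diff_right_eq)
    also have "\<dots> = (- (int (pos z) - int (pos (\<sigma> z))) - 1) mod m" by (simp add: algebra_simps)
    finally show ?thesis 
      using mod_complement[OF m, of "int (pos z) - int (pos (\<sigma> z))"] by (simp add: \<alpha>_def)
  qed
  then have "sum \<alpha> X + sum \<beta> X = (m - 1) * int (card X)"
    by (simp add: sum.distrib[symmetric] mult.commute)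
  moreover have "m * (c + int (card X)) \<le> m * (int (card (d ` B)) + int (card (e ` X)))"
    using c m by (intro mult_left_mono) auto
  ultimately show ?thesis using 1 2 unfolding m_def by (simp add: distrib_left)
qed

section \<open>Cyclically reduced words\<close>

lemma follows_cycle_nth:
  assumes "follows \<tau> (map f [0..<m] @ [hd (map f [0..<m])])" "p < m"
  shows "\<tau> (f p) = f (Suc p mod m)"
proof -
  let ?l = "map f [0..<m] @ [hd (map f [0..<m])]"
  have "\<tau> (?l ! p) = ?l ! Suc p"
    using successively_nth[OF assms(1), of p] assms(2) by simp
  moreover have "?l ! Suc p = f (Suc p mod m)"
    using assms(2) by (cases "Suc p = m") (auto simp: nth_append hd_map hd_upt)
  ultimately show ?thesis using assms(2) by (simp add: nth_append)
qed

lemma map_nth_upt: "map (\<lambda>j. f (xs ! j)) [0..<length xs] = map f xs"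
  by (rule nth_equalityI) simp_all

text \<open>
  The letters are triples \<open>(j, t, p)\<close>: letter number \<open>p\<close> of the \<open>j\<close>-th conjugator for \<open>t = 0\<close> and of the
  \<open>j\<close>-th copy of \<open>g\<close> for \<open>t = 1\<close>. For \<open>t = 2\<close> it is the partner of \<open>(j, 0, p)\<close> in the inverse conjugator.
\<close>
definition copy_letters :: "('i \<times> 'a) list \<Rightarrow> ('i \<times> 'a) list list \<Rightarrow> nat \<Rightarrow>
    ((nat \<times> nat \<times> nat) \<times> (nat \<times> nat \<times> nat)) list \<times> (nat \<times> nat \<times> nat) list" where
  "copy_letters g us j = (map (\<lambda>p. ((j, 0, p), (j, 2, p))) [0..<length (us ! j)],
     map (\<lambda>p. (j, 1, p)) [0..<length g])"

definition copy_label :: "('i \<Rightarrow> ('a, 'b) monoid_scheme) \<Rightarrow> ('i \<times> 'a) list \<Rightarrow> ('i \<times> 'a) list list \<Rightarrow>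
    nat \<times> nat \<times> nat \<Rightarrow> 'i \<times> 'a" where
  "copy_label G g us = (\<lambda>(j, t, p). if t = 0 then us ! j ! p else if t = 1 then g ! p
     else inverse_syllable G (us ! j ! p))"

text \<open>
  With \<open>k\<close> conjugators there are \<open>k + 1\<close> copies of \<open>g\<close>, so the boundary has \<open>(k + 1) m\<close> letters once the
  conjugators are glued up, and the Euler characteristic is \<open>1 - k\<close>. This contradicts
  \<open>diagram_bound\<close>. A conjugator is required to be nonempty because splitting off a circle needs a pair of
  letters to glue.
\<close>
lemma not_trivial_product_of_conjugates:
  assumes G: "\<And>i. i \<in> I \<Longrightarrow> group (G i)" and tf: "\<And>i. i \<in> I \<Longrightarrow> torsion_free (G i)"
    and g: "g \<in> reduced_words I G" "g \<noteq> []" "fst (hd g) \<noteq> fst (last g)"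
    and us: "\<forall>u\<in>set us. u \<noteq> [] \<and> (\<forall>a\<in>set u. valid_letter I G a)"
  shows "foldr (syllable_mult G)
    (g @ concat (map (\<lambda>u. u @ g @ rev (map (inverse_syllable G) u)) us)) [] \<noteq> []"
proof
  assume triv: "foldr (syllable_mult G)
    (g @ concat (map (\<lambda>u. u @ g @ rev (map (inverse_syllable G) u)) us)) [] = []"
  define k m where "k = length us" and "m = length g"
  define q :: "(nat \<times> nat \<times> nat) list" where "q = map (\<lambda>p. (k, 1, p)) [0..<m]"
  let ?C = "copy_letters g us" and ?lab = "copy_label G g us"
  let ?Cs = "map ?C [0..<k]"
  let ?l = "q @ concat (map conjugate_word ?Cs)"
  have m: "0 < m" using g(2) by (simp add: m_def)
  have "q \<noteq> []" using m by (simp add: q_def)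
  have gv: "\<forall>a\<in>set g. valid_letter I G a \<and> snd a \<noteq> \<one>\<^bsub>G (fst a)\<^esub>"
    using g(1) by (auto simp: reduced_words_def valid_letter_def)
  have word: "conjugate_word (?C j) = map (\<lambda>p. (j, 0, p)) [0..<length (us ! j)] @
      map (\<lambda>p. (j, 1, p)) [0..<m] @ rev (map (\<lambda>p. (j, 2, p)) [0..<length (us ! j)])" for j
    by (simp add: conjugate_word_def copy_letters_def m_def comp_def)
  have fst_word: "fst z = j" if "z \<in> set (conjugate_word (?C j))" for z j
    using that unfolding word by auto
  have "distinct (concat (map (\<lambda>j. conjugate_word (?C j)) js))" if "distinct js" for js
    using that
  proof (induction js)
    case (Cons j js)
    have "distinct (conjugate_word (?C j))"
      unfolding word by (auto simp: distinct_map inj_on_def)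
    moreover have "distinct (concat (map (\<lambda>j. conjugate_word (?C j)) js))" using Cons by simp
    moreover have "set (conjugate_word (?C j)) \<inter>
        set (concat (map (\<lambda>j. conjugate_word (?C j)) js)) = {}"
      using Cons.prems by (auto dest: fst_word)
    ultimately show ?case by simp
  qed simp
  moreover have "set q \<inter> set (concat (map (\<lambda>j. conjugate_word (?C j)) [0..<k])) = {}"
    using fst_word by (fastforce simp: q_def)
  moreover have "distinct q" by (auto simp: q_def distinct_map inj_on_def)
  ultimately have dist: "distinct ?l" by (simp add: comp_def)
  have lab_word: "map ?lab (conjugate_word (?C j)) =
      us ! j @ g @ rev (map (inverse_syllable G) (us ! j))" for j
    unfolding word
    by (simp add: copy_label_def rev_map[symmetric] comp_def m_def map_nth_upt[of "\<lambda>x. x", simplified]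
        map_nth_upt[of "inverse_syllable G"])
  have "map ?lab q = g" by (simp add: q_def copy_label_def comp_def m_def map_nth)
  moreover have "map ?lab (concat (map conjugate_word ?Cs)) =
    concat (map (\<lambda>u. u @ g @ rev (map (inverse_syllable G) u)) us)"
    unfolding map_concat map_map comp_def lab_word
    using map_nth_upt[of "\<lambda>u. u @ g @ rev (map (inverse_syllable G) u)" us] by (simp add: k_def)
  ultimately have lab_l: "map ?lab ?l =
      g @ concat (map (\<lambda>u. u @ g @ rev (map (inverse_syllable G) u)) us)"
    by simp
  have "\<forall>a\<in>set (map ?lab ?l). valid_letter I G a"
    unfolding lab_l using gv us inverse_syllable_valid(1)[of I G, OF G] by auto
  then have valid: "\<forall>z\<in>set ?l. valid_letter I G (?lab z)" by auto
  obtain \<sigma> \<tau> where D: "diagram G ?lab (set ?l) \<sigma> \<tau> 1" and f: "follows \<tau> (?l @ [hd ?l])"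
    using diagram_of_trivial_word[where l = ?l and lab = ?lab, OF G _ dist valid] \<open>q \<noteq> []\<close> triv
    unfolding lab_l by auto
  have inv: "inverse_letters G (?lab (j, 0, p)) (?lab (j, 2, p))" if "j < k" "p < length (us ! j)" for j p
  proof -
    have "us ! j \<in> set us" "us ! j ! p \<in> set (us ! j)" using that by (simp_all add: k_def)
    then have "valid_letter I G (us ! j ! p)" using us by blast
    then show ?thesis using inverse_syllable_valid(2)[of I G, OF G] by (simp add: copy_label_def)
  qed
  let ?L = "\<Union>(ps, zs)\<in>set ?Cs. letters_of ps"
  have "\<exists>\<sigma>' \<tau>'. diagram G ?lab (set ?l - ?L) \<sigma>' \<tau>' (1 - int (length ?Cs)) \<and>
    follows \<tau>' (q @ [hd q]) \<and> (\<forall>(ps, zs)\<in>set ?Cs. follows \<tau>' (zs @ [hd zs])) \<and>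
    (\<forall>z. z \<notin> ?L \<longrightarrow> \<tau> z \<notin> ?L \<longrightarrow> \<tau>' z = \<tau> z)"
  proof (rule diagram_split_conjugates[OF D \<open>q \<noteq> []\<close> _ dist])
    show "follows \<tau> (q @ concat (map conjugate_word ?Cs) @ [hd q])"
      using f \<open>q \<noteq> []\<close> by simp
    show "\<forall>(ps, zs)\<in>set ?Cs. ps \<noteq> [] \<and> zs \<noteq> [] \<and>
        (\<forall>(x, x')\<in>set ps. inverse_letters G (?lab x) (?lab x'))"
      using us g(2) inv by (auto simp: copy_letters_def k_def)
  qed auto
  then obtain \<sigma>' \<tau>' where D': "diagram G ?lab (set ?l - ?L) \<sigma>' \<tau>' (1 - int k)"
    and fq: "follows \<tau>' (q @ [hd q])" and fz: "\<forall>(ps, zs)\<in>set ?Cs. follows \<tau>' (zs @ [hd zs])"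
    by auto
  have "letters_of (fst (?C j)) = {j} \<times> {0, 2} \<times> {..<length (us ! j)}" for j
    by (auto simp: copy_letters_def letters_of_def image_iff)
  then have L: "?L = (\<Union>j<k. {j} \<times> {0, 2} \<times> {..<length (us ! j)})"
    by (auto simp: case_prod_beta)
  have X: "set ?l - ?L = {..k} \<times> {1} \<times> {..<m}"
  proof -
    have sw: "set (conjugate_word (?C j)) = {j} \<times> {0, 2} \<times> {..<length (us ! j)} \<union> {j} \<times> {1} \<times> {..<m}" for j
      unfolding word by (auto simp: image_iff)
    have sq: "set q = {k} \<times> {1} \<times> {..<m}" by (auto simp: q_def image_iff)
    have "set ?l = set q \<union> (\<Union>j<k. set (conjugate_word (?C j)))"
      by (simp add: atLeast0LessThan)
    also have "\<dots> - ?L = insert k {..<k} \<times> {1} \<times> {..<m}" unfolding L sw sq by auto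
    also have "insert k {..<k} = {..k}" by auto
    finally show ?thesis .
  qed
  have next_letter: "\<tau>' (j, 1, p) = (j, 1, Suc p mod m)" if "j \<le> k" "p < m" for j p
  proof (cases "j = k")
    case True
    then show ?thesis using follows_cycle_nth[OF fq[unfolded q_def] that(2)] by simp
  next
    case False
    then have "follows \<tau>' (map (\<lambda>p. (j, 1, p)) [0..<m] @ [hd (map (\<lambda>p. (j, 1, p)) [0..<m])])"
      using fz that by (auto simp: copy_letters_def m_def)
    then show ?thesis using follows_cycle_nth that(2) by fast
  qed
  have "int (length g) * ((1 - int k) + int (card (set ?l - ?L))) \<le>
    (int (length g) - 1) * int (card (set ?l - ?L))"
  proof (rule diagram_bound[OF D', where pos = "\<lambda>z. snd (snd z)"])
    fix z assume "z \<in> set ?l - ?L"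
    then obtain j p where z: "z = (j, 1, p)" "j \<le> k" "p < m" unfolding X by auto
    then show "snd (snd z) < length g \<and> ?lab z = g ! snd (snd z) \<and>
        snd (snd (\<tau>' z)) = Suc (snd (snd z)) mod length g"
      using next_letter by (simp add: copy_label_def m_def)
  next
    fix p assume p: "p < length g"
    show "torsion_free (G (fst (g ! p))) \<and> snd (g ! p) \<noteq> \<one>\<^bsub>G (fst (g ! p))\<^esub>"
      using gv tf p by (auto simp: valid_letter_def)
    have adj: "distinct_adj (map fst g)" using g(1) by (auto simp: reduced_words_def)
    show "fst (g ! p) \<noteq> fst (g ! (Suc p mod length g))"
    proof (cases "Suc p = length g")
      case True
      then have "p = length g - 1" by simp
      then show ?thesis using g(2,3) True by (simp add: last_conv_nth hd_conv_nth)
    next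
      case False
      then show ?thesis using adj p by (simp add: distinct_adj_conv_nth)
    qed
  qed (use g in auto)
  moreover have "int (card (set ?l - ?L)) = (int k + 1) * int m"
    unfolding X by (simp add: distrib_right)
  ultimately have "int m * (1 - int k + (int k + 1) * int m) \<le> int m * ((int m - 1) * (int k + 1))"
    by (simp add: m_def mult_ac)
  then have "1 - int k + (int k + 1) * int m \<le> (int m - 1) * (int k + 1)"
    using m by simp
  then show False by (simp add: algebra_simps)
qed

lemma not_generalized_torsion_cyclically_reduced:
  assumes G: "\<And>i. i \<in> I \<Longrightarrow> group (G i)" and tf: "\<And>i. i \<in> I \<Longrightarrow> torsion_free (G i)"
    and g: "g \<in> reduced_words I G" "g \<noteq> []" "fst (hd g) \<noteq> fst (last g)"
  shows "\<not> generalized_torsion (free_product I G) g"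
proof
  let ?P = "free_product I G"
  assume "generalized_torsion ?P g"
  then obtain zs where zs: "zs \<noteq> []" "set zs \<subseteq> carrier ?P"
    "foldr (\<otimes>\<^bsub>?P\<^esub>) (map (\<lambda>x. x \<otimes>\<^bsub>?P\<^esub> g \<otimes>\<^bsub>?P\<^esub> inv\<^bsub>?P\<^esub> x) zs) \<one>\<^bsub>?P\<^esub> = \<one>\<^bsub>?P\<^esub>"
    unfolding generalized_torsion_def by blast
  obtain x0 xs where x0: "zs = x0 # xs" using zs(1) by (cases zs) auto
  have xs: "x0 \<in> carrier ?P" "set xs \<subseteq> carrier ?P" and
    prod: "foldr (\<otimes>\<^bsub>?P\<^esub>) (map (\<lambda>x. x \<otimes>\<^bsub>?P\<^esub> g \<otimes>\<^bsub>?P\<^esub> inv\<^bsub>?P\<^esub> x) (x0 # xs)) \<one>\<^bsub>?P\<^esub> = \<one>\<^bsub>?P\<^esub>"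
    using zs unfolding x0 by auto
  interpret P: group ?P using G by (rule group_free_product)
  have gc: "g \<in> carrier ?P" using g by simp
  \<comment> \<open>Conjugating the relation by \<open>inv x0\<close> turns its first factor into \<open>g\<close> itself.\<close>
  define ys where "ys = map ((\<otimes>\<^bsub>?P\<^esub>) (inv\<^bsub>?P\<^esub> x0)) xs"
  have ys: "set ys \<subseteq> carrier ?P"
    using xs P.m_closed[OF P.inv_closed[OF xs(1)]]
    unfolding ys_def by (auto simp del: free_product_simps)
  have "foldr (\<otimes>\<^bsub>?P\<^esub>) (map (\<lambda>x. x \<otimes>\<^bsub>?P\<^esub> g \<otimes>\<^bsub>?P\<^esub> inv\<^bsub>?P\<^esub> x) (map ((\<otimes>\<^bsub>?P\<^esub>) (inv\<^bsub>?P\<^esub> x0)) (x0 # xs))) \<one>\<^bsub>?P\<^esub>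
    = inv\<^bsub>?P\<^esub> x0 \<otimes>\<^bsub>?P\<^esub> \<one>\<^bsub>?P\<^esub> \<otimes>\<^bsub>?P\<^esub> inv\<^bsub>?P\<^esub> (inv\<^bsub>?P\<^esub> x0)"
    using P.foldr_conjugates_shift[OF gc P.inv_closed[OF xs(1)], of "x0 # xs"] xs prod by auto
  also have "\<dots> = \<one>\<^bsub>?P\<^esub>" using P.r_one P.inv_inv P.l_inv P.inv_closed xs(1) by metis
  finally have "(\<one>\<^bsub>?P\<^esub> \<otimes>\<^bsub>?P\<^esub> g \<otimes>\<^bsub>?P\<^esub> inv\<^bsub>?P\<^esub> \<one>\<^bsub>?P\<^esub>) \<otimes>\<^bsub>?P\<^esub>
      foldr (\<otimes>\<^bsub>?P\<^esub>) (map (\<lambda>x. x \<otimes>\<^bsub>?P\<^esub> g \<otimes>\<^bsub>?P\<^esub> inv\<^bsub>?P\<^esub> x) ys) \<one>\<^bsub>?P\<^esub> = \<one>\<^bsub>?P\<^esub>"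
    unfolding list.map foldr.simps comp_def P.l_inv[OF xs(1)] ys_def[symmetric] .
  then have eq: "g \<otimes>\<^bsub>?P\<^esub> foldr (\<otimes>\<^bsub>?P\<^esub>) (map (\<lambda>x. x \<otimes>\<^bsub>?P\<^esub> g \<otimes>\<^bsub>?P\<^esub> inv\<^bsub>?P\<^esub> x) ys) \<one>\<^bsub>?P\<^esub> = \<one>\<^bsub>?P\<^esub>"
    unfolding P.inv_one P.l_one[OF gc] P.r_one[OF gc] .
  define i where "i = fst (hd g)"
  have i: "i \<in> I" using g by (cases g) (auto simp: i_def reduced_words_Cons)
  \<comment> \<open>The trivial letter in front makes every conjugator nonempty, even if \<open>y\<close> is the empty word.\<close>
  define us where "us = map (\<lambda>y. (i, \<one>\<^bsub>G i\<^esub>) # y) ys"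
  have inv1: "inverse_syllable G (i, \<one>\<^bsub>G i\<^esub>) = (i, \<one>\<^bsub>G i\<^esub>)"
    using monoid.inv_one[OF group.is_monoid[OF G[OF i]]] by (simp add: inverse_syllable_def)
  have eval: "foldr (syllable_mult G) (concat (map (\<lambda>u. u @ g @ rev (map (inverse_syllable G) u))
      (map (\<lambda>y. (i, \<one>\<^bsub>G i\<^esub>) # y) zs))) [] =
    foldr (\<otimes>\<^bsub>?P\<^esub>) (map (\<lambda>x. x \<otimes>\<^bsub>?P\<^esub> g \<otimes>\<^bsub>?P\<^esub> inv\<^bsub>?P\<^esub> x) zs) \<one>\<^bsub>?P\<^esub>" if "set zs \<subseteq> carrier ?P" for zs
    using that
  proof (induction zs)
    case (Cons y zs)
    let ?r = "foldr (\<otimes>\<^bsub>?P\<^esub>) (map (\<lambda>x. x \<otimes>\<^bsub>?P\<^esub> g \<otimes>\<^bsub>?P\<^esub> inv\<^bsub>?P\<^esub> x) zs) \<one>\<^bsub>?P\<^esub>"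
    have r: "?r \<in> reduced_words I G"
      using P.foldr_conjugates_shift[OF gc P.one_closed, of zs] Cons.prems by simp
    have "y \<in> reduced_words I G" using Cons.prems by simp
    note conj = foldr_syllable_mult_conjugate[OF G this g(1) r]
    let ?w = "\<lambda>zs. concat (map (\<lambda>u. u @ g @ rev (map (inverse_syllable G) u)) (map (\<lambda>y. (i, \<one>\<^bsub>G i\<^esub>) # y) zs))"
    have "foldr (syllable_mult G) (?w (y # zs)) [] =
      foldr (syllable_mult G) (y @ g @ rev (map (inverse_syllable G) y)) (foldr (syllable_mult G) (?w zs) [])"
      by (simp add: inv1)
    also have "foldr (syllable_mult G) (?w zs) [] = ?r" using Cons by (simp del: free_product_simps)
    also note conj
    finally show ?case unfolding list.map foldr.simps comp_def .
  qed simp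
  have "foldr (syllable_mult G)
    (g @ concat (map (\<lambda>u. u @ g @ rev (map (inverse_syllable G) u)) us)) [] = []"
    using eq eval[OF ys] by (simp add: us_def)
  moreover have "\<forall>u\<in>set us. u \<noteq> [] \<and> (\<forall>a\<in>set u. valid_letter I G a)"
  proof -
    have "valid_letter I G (i, \<one>\<^bsub>G i\<^esub>)"
      using i group.is_monoid[OF G[OF i]] by (simp add: valid_letter_def)
    moreover have "valid_letter I G a" if "y \<in> set ys" "a \<in> set y" for y a
      using reduced_word_letters[of y I G a] ys that by auto
    ultimately show ?thesis by (auto simp: us_def)
  qed
  ultimately show False using not_trivial_product_of_conjugates[OF G tf g] by blast
qed

section \<open>Generalized torsion in free products\<close>

text \<open>
  Apply the retraction onto \<open>G i\<close> that is trivial on the other factors.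
\<close>
lemma generalized_torsion_syllable:
  assumes G: "\<And>i. i \<in> I \<Longrightarrow> group (G i)" and x: "[(i, x)] \<in> reduced_words I G"
    and gt: "generalized_torsion (free_product I G) [(i, x)]"
  shows "generalized_torsion (G i) x"
proof -
  have ix: "i \<in> I" "x \<in> carrier (G i)" "x \<noteq> \<one>\<^bsub>G i\<^esub>" using x by (auto simp: reduced_words_Cons)
  have "(\<lambda>x. if j = i then x else \<one>\<^bsub>G i\<^esub>) \<in> hom (G j) (G i)" if "j \<in> I" for j
    using group.is_monoid[OF G[OF ix(1)]] by (auto simp: hom_def monoid.l_one)
  from free_product_universal[of I G "G i" "\<lambda>j x. if j = i then x else \<one>\<^bsub>G i\<^esub>", OF G G[OF ix(1)] this]
  obtain F where F: "F \<in> hom (free_product I G) (G i)"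
    and Fx: "\<And>x. x \<in> carrier (G i) \<Longrightarrow> F (free_product_incl G i x) = x"
    using ix(1) by fastforce
  have "F [(i, x)] = x" using Fx[OF ix(2)] ix(3) by (simp add: free_product_incl_def)
  then show ?thesis
    using generalized_torsion_hom[OF group_free_product[OF G] G[OF ix(1)] F gt] ix(3) by simp
qed

theorem theorem1p5:
  fixes n :: nat and G :: "nat \<Rightarrow> ('a, 'b) monoid_scheme"
  assumes "1 \<le> n"
    and "\<And>i. i \<in> {1..n} \<Longrightarrow> group (G i)"
    and "\<And>i. i \<in> {1..n} \<Longrightarrow> torsion_free (G i)"
  shows "(\<forall>g. generalized_torsion (free_product {1..n} G) g \<longrightarrow>
            (\<exists>i \<in> {1..n}. \<exists>g\<^sub>i. generalized_torsion (G i) g\<^sub>i \<and>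
               conjugate_in (free_product {1..n} G) (free_product_incl G i g\<^sub>i) g)) \<and>
         ((\<exists>g. generalized_torsion (free_product {1..n} G) g) \<longleftrightarrow>
            (\<exists>i \<in> {1..n}. \<exists>g\<^sub>i. generalized_torsion (G i) g\<^sub>i))"
proof -
  let ?P = "free_product {1..n} G"
  interpret P: group ?P using assms(2) by (rule group_free_product)
  have factor: "\<exists>i \<in> {1..n}. \<exists>x. generalized_torsion (G i) x \<and> conjugate_in ?P (free_product_incl G i x) g"
    if g: "generalized_torsion ?P g" for g
  proof -
    have gc: "g \<in> reduced_words {1..n} G" "g \<noteq> []" using g by (auto simp: generalized_torsion_def)
    obtain v h where v: "v \<in> reduced_words {1..n} G" "h \<in> reduced_words {1..n} G"
      "v = h \<otimes>\<^bsub>?P\<^esub> g \<otimes>\<^bsub>?P\<^esub> inv\<^bsub>?P\<^esub> h" "v \<noteq> []" "length v = 1 \<or> fst (hd v) \<noteq> fst (last v)"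
      using conjugate_cyclically_reduced[OF assms(2) gc] by blast
    have hc: "h \<in> carrier ?P" "g \<in> carrier ?P" using v gc by simp_all
    have gv: "generalized_torsion ?P v"
      unfolding v(3) by (rule P.generalized_torsion_conjugate[OF g hc(1)])
    then have "length v = 1"
      using not_generalized_torsion_cyclically_reduced[OF assms(2,3) v(1,4)] v(5) by blast
    then obtain i x where vx: "v = [(i, x)]" by (auto simp: length_Suc_conv)
    have ix: "i \<in> {1..n}" "x \<noteq> \<one>\<^bsub>G i\<^esub>" using v(1) unfolding vx by (auto simp: reduced_words_Cons)
    have "g = inv\<^bsub>?P\<^esub> h \<otimes>\<^bsub>?P\<^esub> v \<otimes>\<^bsub>?P\<^esub> inv\<^bsub>?P\<^esub> (inv\<^bsub>?P\<^esub> h)"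
      unfolding v(3) using P.conjugate_inv_conjugate[OF hc] by (rule sym)
    then have "conjugate_in ?P (free_product_incl G i x) g"
      unfolding conjugate_in_def using P.inv_closed[OF hc(1)] vx ix(2)
      by (auto simp: free_product_incl_def)
    moreover have "generalized_torsion (G i) x"
      by (rule generalized_torsion_syllable[OF assms(2)]) (use v(1) gv vx in auto)
    ultimately show ?thesis using ix(1) by blast
  qed
  have "generalized_torsion ?P (free_product_incl G i x)"
    if i: "i \<in> {1..n}" and x: "generalized_torsion (G i) x" for i x
  proof (rule generalized_torsion_hom[OF assms(2)[OF i] P.is_group _ x])
    show "free_product_incl G i \<in> hom (G i) ?P"
      using free_product_incl_hom[of "{1..n}" G] assms(2) i by blast
    show "free_product_incl G i x \<noteq> \<one>\<^bsub>?P\<^esub>"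
      using x by (simp add: generalized_torsion_def free_product_incl_def)
  qed
  then show ?thesis using factor by blast
qed

end
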